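(* Let $n\ge 1$, let $H\in C(\mathbb{R}^n)$ be coercive (i.e. $H(p)\to+\infty$ as $|p|\to\infty$), let $V_1\in C(\mathbb{R}^n)$ be $\mathbb{Z}^n$-periodic, and let $V_2\equiv 0$. For $i=1,2$ let $\overline H_i:\mathbb{R}^n\to\mathbb{R}$ be the effective Hamiltonian associated with $H_i(p,x)=H(p)+V_i(x)$. Suppose that there exists $p_0\in\mathbb{R}^n$ such that $H$ is differentiable at $p_0$ and $DH(p_0)$ is an irrational vector, i.e. $DH(p_0)\cdot m\neq 0$ for all $m\in\mathbb{Z}^n\setminus\{0\}$. Then $$\overline H_1(p_0)=\overline H_2(p_0)\ \text{ and }\ \min_{\mathbb{R}^n}\overline H_1=\min_{\mathbb{R}^n}\overline H_2\quad\Longrightarrow\quad V_1\equiv 0.$$ In particular, $$\overline H_1\equiv\overline H_2\quad\Longrightarrow\quad V_1\equiv 0.$$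
   Context: $\mathbb{T}^n=\mathbb{R}^n/\mathbb{Z}^n$. For a continuous coercive $H:\mathbb{R}^n\to\mathbb{R}$ and a continuous $\mathbb{Z}^n$-periodic $V:\mathbb{R}^n\to\mathbb{R}$, the effective Hamiltonian $\overline H:\mathbb{R}^n\to\mathbb{R}$ associated with $H(p)+V(x)$ is defined as follows: for each $p\in\mathbb{R}^n$, $\overline H(p)$ is the unique constant $c\in\mathbb{R}$ such that the cell problem $$H(p+Dv(x))+V(x)=c\quad\text{in }\mathbb{T}^n$$ has a continuous ($\mathbb{Z}^n$-periodic) viscosity solution $v\in C(\mathbb{T}^n)$ (existence and uniqueness of $c$ are due to Lions–Papanicolaou–Varadhan). *)

theory Defs
  imports "HOL-Analysis.Analysis"
begin

definition integer_vectors :: "(real ^ 'n) set" where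
  "integer_vectors = {m. \<forall>i. m $ i \<in> \<int>}"

text \<open>Functions on the torus are represented by periodic functions on the whole space.\<close>

definition Zn_periodic :: "(real ^ 'n \<Rightarrow> real) \<Rightarrow> bool" where
  "Zn_periodic f \<longleftrightarrow> (\<forall>x. \<forall>m\<in>integer_vectors. f (x + m) = f x)"

definition coercive :: "(real ^ 'n \<Rightarrow> real) \<Rightarrow> bool" where
  "coercive H \<longleftrightarrow> filterlim H at_top at_infinity"

definition irrational_vector :: "real ^ 'n \<Rightarrow> bool" where
  "irrational_vector q \<longleftrightarrow> (\<forall>m \<in> integer_vectors - {0}. q \<bullet> m \<noteq> 0)"

text \<open>The function \<open>\<phi>\<close> is of class \<open>C\<^sup>1\<close> with gradient \<open>D\<phi>\<close>.\<close>

definition C1_with_gradient :: "(real ^ 'n \<Rightarrow> real) \<Rightarrow> (real ^ 'n \<Rightarrow> real ^ 'n) \<Rightarrow> bool" where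
  "C1_with_gradient \<phi> D\<phi> \<longleftrightarrow> (\<forall>x. GDERIV \<phi> x :> D\<phi> x) \<and> continuous_on UNIV D\<phi>"

definition local_max_at :: "(real ^ 'n \<Rightarrow> real) \<Rightarrow> real ^ 'n \<Rightarrow> bool" where
  "local_max_at f x \<longleftrightarrow> (\<forall>\<^sub>F y in nhds x. f y \<le> f x)"

definition local_min_at :: "(real ^ 'n \<Rightarrow> real) \<Rightarrow> real ^ 'n \<Rightarrow> bool" where
  "local_min_at f x \<longleftrightarrow> (\<forall>\<^sub>F y in nhds x. f x \<le> f y)"

text \<open>Viscosity sub- and supersolutions of \<open>F (Dv(x), x) = c\<close>, for a general first-order
  operator \<open>F\<close> (gradient first, position second).  Continuity of \<open>v\<close> is required separately.\<close>

definition viscosity_subsolution ::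
    "(real ^ 'n \<Rightarrow> real ^ 'n \<Rightarrow> real) \<Rightarrow> real \<Rightarrow> (real ^ 'n \<Rightarrow> real) \<Rightarrow> bool" where
  "viscosity_subsolution F c v \<longleftrightarrow>
     (\<forall>\<phi> D\<phi> x. C1_with_gradient \<phi> D\<phi> \<and> local_max_at (\<lambda>y. v y - \<phi> y) x \<longrightarrow> F (D\<phi> x) x \<le> c)"

definition viscosity_supersolution ::
    "(real ^ 'n \<Rightarrow> real ^ 'n \<Rightarrow> real) \<Rightarrow> real \<Rightarrow> (real ^ 'n \<Rightarrow> real) \<Rightarrow> bool" where
  "viscosity_supersolution F c v \<longleftrightarrow>
     (\<forall>\<phi> D\<phi> x. C1_with_gradient \<phi> D\<phi> \<and> local_min_at (\<lambda>y. v y - \<phi> y) x \<longrightarrow> c \<le> F (D\<phi> x) x)"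

definition viscosity_solution ::
    "(real ^ 'n \<Rightarrow> real ^ 'n \<Rightarrow> real) \<Rightarrow> real \<Rightarrow> (real ^ 'n \<Rightarrow> real) \<Rightarrow> bool" where
  "viscosity_solution F c v \<longleftrightarrow> viscosity_subsolution F c v \<and> viscosity_supersolution F c v"

definition cell_problem_solvable ::
    "(real ^ 'n \<Rightarrow> real) \<Rightarrow> (real ^ 'n \<Rightarrow> real) \<Rightarrow> real ^ 'n \<Rightarrow> real \<Rightarrow> bool" where
  "cell_problem_solvable H V p c \<longleftrightarrow>
     (\<exists>v. continuous_on UNIV v \<and> Zn_periodic v \<and>
          viscosity_solution (\<lambda>q x. H (p + q) + V x) c v)"

text \<open>For continuous coercive \<open>H\<close> and continuous periodic \<open>V\<close> the description below is proper by
  the theorem of Lions, Papanicolaou and Varadhan; for other data the value is meaningless.\<close>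

definition effective_hamiltonian ::
    "(real ^ 'n \<Rightarrow> real) \<Rightarrow> (real ^ 'n \<Rightarrow> real) \<Rightarrow> real ^ 'n \<Rightarrow> real" where
  "effective_hamiltonian H V p = (THE c. cell_problem_solvable H V p c)"

text \<open>The minimum of \<open>f\<close>, as the least element of its range; meaningful only if it is attained.\<close>

definition minimum :: "(real ^ 'n \<Rightarrow> real) \<Rightarrow> real" where
  "minimum f = (LEAST m. m \<in> range f)"

end

theory Submission
  imports Defs "HOL-Complex_Analysis.Great_Picard"
begin

text \<open>With zero potential the effective Hamiltonian is \<open>H\<close> itself, and in general its minimum is
  \<open>min H + max V\<^sub>1\<close>; hence equal minima give \<open>V\<^sub>1 \<le> 0\<close>. Suppose \<open>V\<^sub>1\<close> is negative somewhere and let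
  \<open>q = DH(p\<^sub>0)\<close>. Majorize \<open>V\<^sub>1\<close> by a trigonometric polynomial of negative mean; as \<open>q\<close> is
  irrational, subtracting the mean leaves a function of the form \<open>- q \<bullet> D\<psi>\<close> with \<open>\<psi>\<close> periodic, so that
  \<open>V\<^sub>1 + q \<bullet> D\<psi> \<le> - \<eta> < 0\<close>. For small \<open>k > 0\<close> the function \<open>k \<psi>\<close> is then a strict subsolution
  of the cell problem at \<open>p\<^sub>0\<close> with right-hand side \<open>H(p\<^sub>0)\<close>, which contradicts the supersolution property
  of a corrector \<open>v\<close> at a minimum point of \<open>v - k \<psi>\<close>.\<close>

section \<open>Test functions and periodic functions\<close>

text \<open>\<open>H\<close> is not assumed convex and its derivative is known only at
  \<open>p0\<close>, so the perturbation has to be small: along \<open>k * \<psi>\<close> the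
  kinetic part changes by \<open>k * (q \<bullet> D\<psi>) + o(k)\<close>. The potential is not
  scaled by \<open>k\<close>, but \<open>V1 \<le> 0\<close> and \<open>k \<le> 1\<close> give
  \<open>V1 \<le> k * V1\<close>, and the two together contribute at most
  \<open>- k * \<eta> + o(k)\<close>; this is where the sign obtained from the minima enters.
  Correcting \<open>V1\<close> itself to its mean may fail, since the divisors
  \<open>q \<bullet> m\<close> can come arbitrarily close to zero. An inequality is enough, and a
  majorant with finitely many frequencies meets only finitely many divisors. Most of the development
  serves the definite description behind \<open>effective_hamiltonian\<close>: its value is
  accessible only through the Lions-Papanicolaou-Varadhan theorem, proved here with existence by
  Perron's method and vanishing discount, and uniqueness by doubling of variables.\<close>

lemma coercive_attains_inf:
  fixes f :: "'a::{real_normed_vector,heine_borel} \<Rightarrow> real"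
  assumes cont: "continuous_on UNIV f" and lim: "filterlim f at_top at_infinity"
  obtains x where "\<And>y. f x \<le> f y"
proof -
  have "\<forall>\<^sub>F y in at_infinity. f 0 \<le> f y"
    using lim by (simp add: filterlim_at_top)
  then obtain b where b: "\<And>y. norm y \<ge> b \<Longrightarrow> f 0 \<le> f y"
    by (auto simp: eventually_at_infinity)
  define S :: "'a set" where "S = cball 0 (max b 0)"
  have "compact S" "S \<noteq> {}" "0 \<in> S" unfolding S_def by auto
  moreover have "continuous_on S f" using cont continuous_on_subset by blast
  ultimately obtain x where x: "x \<in> S" "\<And>y. y \<in> S \<Longrightarrow> f x \<le> f y"
    using continuous_attains_inf[of S f] by blast
  have "f x \<le> f y" for y
  proof (cases "y \<in> S")
    case False
    then have "norm y \<ge> b" by (auto simp: S_def)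
    then show ?thesis using b x(2)[OF \<open>0 \<in> S\<close>] by force
  qed (use x in auto)
  then show ?thesis using that by blast
qed

text \<open>Growth of the test function replaces compactness: the candidates in Perron's method are
  bounded above but not periodic, so contact points with them have to be forced.\<close>

lemma bounded_above_minus_coercive_attains_sup:
  fixes u \<phi> :: "'a::{real_normed_vector,heine_borel} \<Rightarrow> real"
  assumes "continuous_on UNIV u" "continuous_on UNIV \<phi>"
    and bound: "\<And>y. u y \<le> B" and lim: "filterlim \<phi> at_top at_infinity"
  obtains x where "\<And>y. u y - \<phi> y \<le> u x - \<phi> x"
proof -
  have "filterlim (\<lambda>y. - B + \<phi> y) at_top at_infinity"
    using lim by (rule filterlim_tendsto_add_at_top[OF tendsto_const])
  then have "filterlim (\<lambda>y. \<phi> y - u y) at_top at_infinity"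
    by (rule filterlim_at_top_mono) (use bound in \<open>auto simp: algebra_simps\<close>)
  moreover have "continuous_on UNIV (\<lambda>y. \<phi> y - u y)"
    using assms by (intro continuous_intros)
  ultimately obtain x where x: "\<And>y. \<phi> x - u x \<le> \<phi> y - u y"
    using coercive_attains_inf[of "\<lambda>y. \<phi> y - u y"] by blast
  have "u y - \<phi> y \<le> u x - \<phi> x" for y using x[of y] by linarith
  then show ?thesis by (rule that)
qed

section \<open>Calculus of C1 test functions\<close>

lemma C1_imp_continuous:
  assumes "C1_with_gradient \<phi> D\<phi>"
  shows "continuous_on UNIV \<phi>"
  using assms unfolding C1_with_gradient_def gderiv_def
  by (meson continuous_at_imp_continuous_on has_derivative_continuous)

lemma C1_const: "C1_with_gradient (\<lambda>y. c) (\<lambda>y. 0)"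
  by (simp add: C1_with_gradient_def GDERIV_const)

lemma C1_add:
  assumes "C1_with_gradient f Df" "C1_with_gradient g Dg"
  shows "C1_with_gradient (\<lambda>y. f y + g y) (\<lambda>y. Df y + Dg y)"
  using assms unfolding C1_with_gradient_def by (simp add: GDERIV_add continuous_on_add)

lemma C1_minus:
  assumes "C1_with_gradient f Df"
  shows "C1_with_gradient (\<lambda>y. - f y) (\<lambda>y. - Df y)"
  using assms unfolding C1_with_gradient_def by (simp add: GDERIV_minus continuous_on_minus)

lemma C1_scale:
  assumes "C1_with_gradient f Df"
  shows "C1_with_gradient (\<lambda>y. k * f y) (\<lambda>y. k *\<^sub>R Df y)"
  using assms unfolding C1_with_gradient_def gderiv_def inner_scaleR_right
  by (auto intro!: has_derivative_mult_right continuous_on_scaleR)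

lemma C1_sum:
  assumes "\<And>i. i \<in> I \<Longrightarrow> C1_with_gradient (f i) (Df i)"
  shows "C1_with_gradient (\<lambda>y. \<Sum>i\<in>I. f i y) (\<lambda>y. \<Sum>i\<in>I. Df i y)"
  using assms by (induction I rule: infinite_finite_induct) (auto simp: C1_const C1_add)

lemma C1_translation:
  assumes "C1_with_gradient f Df"
  shows "C1_with_gradient (\<lambda>y. f (y + m)) (\<lambda>y. Df (y + m))"
proof -
  have "GDERIV (\<lambda>y. f (y + m)) x :> Df (x + m)" for x
  proof -
    have "((\<lambda>y. y + m) has_derivative (\<lambda>h. h)) (at x)"
      by (auto intro!: derivative_eq_intros)
    moreover have "(f has_derivative (\<lambda>h. h \<bullet> Df (x + m))) (at (x + m))"
      using assms by (simp add: C1_with_gradient_def gderiv_def)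
    ultimately show ?thesis
      unfolding gderiv_def by (rule has_derivative_compose)
  qed
  moreover have "continuous_on UNIV (\<lambda>y. Df (y + m))"
    using assms unfolding C1_with_gradient_def
    by (intro continuous_on_compose2[of UNIV Df UNIV "\<lambda>y. y + m"])
      (auto intro: continuous_on_add continuous_on_id continuous_on_const)
  ultimately show ?thesis by (simp add: C1_with_gradient_def)
qed

lemma C1_norm_square: "C1_with_gradient (\<lambda>y. (norm (y - a))\<^sup>2) (\<lambda>y. 2 *\<^sub>R (y - a))"
proof -
  have "((\<lambda>y. (y - a) \<bullet> (y - a)) has_derivative (\<lambda>h. (x - a) \<bullet> (h - 0) + (h - 0) \<bullet> (x - a))) (at x)" for x
    by (intro derivative_intros)
  then have "GDERIV (\<lambda>y. (norm (y - a))\<^sup>2) x :> 2 *\<^sub>R (x - a)" for x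
    by (simp add: gderiv_def power2_norm_eq_inner inner_commute)
  moreover have "continuous_on UNIV (\<lambda>y. 2 *\<^sub>R (y - a))"
    by (intro continuous_intros)
  ultimately show ?thesis unfolding C1_with_gradient_def by blast
qed

text \<open>A cone is not differentiable at its vertex. Rounding it at scale \<open>s\<close> makes
  it an admissible test function, keeps the linear growth, and keeps the slope below that of the
  cone.\<close>

lemma C1_smoothed_cone:
  fixes a :: "real ^ 'n"
  assumes "s > 0"
  shows "C1_with_gradient (\<lambda>y. k * sqrt ((norm (y - a))\<^sup>2 + s\<^sup>2))
           (\<lambda>y. (k / sqrt ((norm (y - a))\<^sup>2 + s\<^sup>2)) *\<^sub>R (y - a))"
proof -
  define r where "r = (\<lambda>y. sqrt ((norm (y - a))\<^sup>2 + s\<^sup>2))"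
  have "0 < s\<^sup>2" using assms by (rule zero_less_power)
  then have pos: "(norm (y - a))\<^sup>2 + s\<^sup>2 > 0" for y
    by (rule add_nonneg_pos[OF zero_le_power2])
  have r_ne: "r y \<noteq> 0" for y
    using real_sqrt_gt_zero[OF pos[of y]] unfolding r_def by linarith
  have "GDERIV (\<lambda>y. (norm (y - a))\<^sup>2) x :> 2 *\<^sub>R (x - a)" for x
    using C1_norm_square[of a] by (simp only: C1_with_gradient_def)
  then have inner: "GDERIV (\<lambda>y. (norm (y - a))\<^sup>2 + s\<^sup>2) x :> 2 *\<^sub>R (x - a) + 0" for x
    by (rule GDERIV_add[OF _ GDERIV_const])
  have "GDERIV r x :> (inverse (r x) / 2) *\<^sub>R (2 *\<^sub>R (x - a) + 0)" for x
    unfolding r_def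
    by (rule GDERIV_DERIV_compose[where g = sqrt]) (rule inner, rule DERIV_real_sqrt[OF pos])
  then have "GDERIV r x :> (1 / r x) *\<^sub>R (x - a)" for x
    by (simp add: inverse_eq_divide)
  moreover have r_cont: "continuous_on UNIV r"
    unfolding r_def by (intro continuous_intros)
  have "continuous_on UNIV (\<lambda>x. (1 / r x) *\<^sub>R (x - a))"
    using r_ne by (intro continuous_on_scaleR continuous_on_divide continuous_on_const r_cont
        continuous_on_diff continuous_on_id) blast
  ultimately have "C1_with_gradient r (\<lambda>x. (1 / r x) *\<^sub>R (x - a))"
    unfolding C1_with_gradient_def by simp
  then have "C1_with_gradient (\<lambda>y. k * r y) (\<lambda>y. k *\<^sub>R ((1 / r y) *\<^sub>R (y - a)))"
    by (rule C1_scale)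
  then show ?thesis by (simp only: r_def scaleR_scaleR times_divide_eq_right mult_1_right)
qed

lemma filterlim_smoothed_cone:
  fixes a :: "'a::real_normed_vector"
  assumes "k > 0"
  shows "filterlim (\<lambda>y. k * sqrt ((norm (y - a))\<^sup>2 + s\<^sup>2)) at_top at_infinity"
proof -
  have "filterlim (\<lambda>y. k * (- norm a + norm y)) at_top at_infinity"
    using assms by (intro filterlim_tendsto_pos_mult_at_top[OF tendsto_const]
        filterlim_tendsto_add_at_top[OF tendsto_const] filterlim_norm_at_top)
  moreover have "k * (- norm a + norm y) \<le> k * sqrt ((norm (y - a))\<^sup>2 + s\<^sup>2)" for y
  proof -
    have "- norm a + norm y \<le> norm (y - a)" using norm_triangle_ineq2[of y a] by simp
    also have "\<dots> \<le> sqrt ((norm (y - a))\<^sup>2 + s\<^sup>2)" by (rule real_le_rsqrt) simp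
    finally show ?thesis using assms by simp
  qed
  ultimately show ?thesis
    by (blast intro: filterlim_at_top_mono always_eventually)
qed

text \<open>Where the tested function is itself differentiable, the viscosity test sees only its
  true gradient; constants and smooth bumps can thus be checked classically.\<close>

lemma gradient_eq_at_local_max:
  assumes "GDERIV f x :> D" "GDERIV g x :> E" "local_max_at (\<lambda>y. f y - g y) x"
  shows "D = E"
proof -
  have d: "((\<lambda>y. f y - g y) has_derivative (\<lambda>h. h \<bullet> (D - E))) (at x)"
    using GDERIV_diff[OF assms(1,2)] by (simp add: gderiv_def)
  obtain e where e: "e > 0" "\<And>y. dist y x < e \<Longrightarrow> f y - g y \<le> f x - g x"
    using assms(3) unfolding local_max_at_def eventually_nhds_metric by blast
  have "(\<lambda>h. h \<bullet> (D - E)) = (\<lambda>v. 0)"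
    by (rule differential_zero_maxmin[OF _ open_ball[of x e] d])
      (use e in \<open>auto simp: dist_commute\<close>)
  then have "(D - E) \<bullet> (D - E) = 0" by (rule fun_cong)
  then show ?thesis by simp
qed

lemma local_max_at_global: "(\<And>y. f y \<le> f x) \<Longrightarrow> local_max_at f x"
  by (simp add: local_max_at_def)

lemma local_min_at_global: "(\<And>y. f x \<le> f y) \<Longrightarrow> local_min_at f x"
  by (simp add: local_min_at_def)

section \<open>Periodic functions and reduction to the unit cube\<close>

lemma integer_vectors_uminus: "m \<in> integer_vectors \<Longrightarrow> - m \<in> integer_vectors"
  by (simp add: integer_vectors_def)

lemma Zn_periodic_minus: "Zn_periodic f \<Longrightarrow> m \<in> integer_vectors \<Longrightarrow> f (x - m) = f x"
  unfolding Zn_periodic_def by (metis diff_add_cancel)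

definition frac_vector :: "real ^ 'n \<Rightarrow> real ^ 'n" where
  "frac_vector x = (\<chi> i. frac (x $ i))"

lemma frac_vector_in_unit_cube: "frac_vector x \<in> cbox 0 (vec 1)"
  by (auto simp: frac_vector_def mem_box_cart less_imp_le[OF frac_lt_1])

text \<open>Two points at offset \<open>z\<close> are moved by the same lattice vector, so
  quantities depending on both points can be reduced to a compact set without changing the
  offset.\<close>

lemma Zn_periodic_frac_vector_add:
  fixes x :: "real ^ 'n"
  assumes "Zn_periodic f"
  shows "f (frac_vector x + z) = f (x + z)"
proof -
  have eq: "frac_vector x + z = (x + z) - (\<chi> i. of_int \<lfloor>x $ i\<rfloor>)"
    by (simp add: frac_vector_def vec_eq_iff frac_def)
  have "(\<chi> i. of_int \<lfloor>x $ i\<rfloor>) \<in> (integer_vectors :: (real ^ 'n) set)"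
    by (simp add: integer_vectors_def)
  then show ?thesis unfolding eq by (rule Zn_periodic_minus[OF assms])
qed

lemma Zn_periodic_frac_vector: "Zn_periodic f \<Longrightarrow> f (frac_vector x) = f x"
  using Zn_periodic_frac_vector_add[of f x 0] by simp

lemma Zn_periodic_attains_sup:
  fixes f :: "real ^ 'n \<Rightarrow> real"
  assumes "continuous_on UNIV f" "Zn_periodic f"
  obtains x where "\<And>y. f y \<le> f x"
proof -
  have "compact (cbox 0 (vec 1 :: real ^ 'n))" "cbox 0 (vec 1 :: real ^ 'n) \<noteq> {}"
    using frac_vector_in_unit_cube by (auto intro: compact_cbox)
  moreover have "continuous_on (cbox 0 (vec 1)) f"
    using assms(1) continuous_on_subset by blast
  ultimately obtain x where x: "\<And>y. y \<in> cbox 0 (vec 1) \<Longrightarrow> f y \<le> f x"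
    using continuous_attains_sup[of "cbox 0 (vec 1)" f] by blast
  have "f y \<le> f x" for y
    using x[OF frac_vector_in_unit_cube[of y]] Zn_periodic_frac_vector[OF assms(2)] by simp
  then show ?thesis by (rule that)
qed

lemma Zn_periodic_minus_fun: "Zn_periodic f \<Longrightarrow> Zn_periodic (\<lambda>x. - f x)"
  by (simp add: Zn_periodic_def)

lemma Zn_periodic_attains_inf:
  assumes "continuous_on UNIV f" "Zn_periodic f"
  obtains x where "\<And>y. f x \<le> f y"
proof -
  obtain x where "\<And>y. - f y \<le> - f x"
    using Zn_periodic_attains_sup[of "\<lambda>x. - f x"] assms Zn_periodic_minus_fun continuous_on_minus
    by blast
  then show ?thesis using that by auto
qed

lemma Zn_periodic_bounded:
  assumes "continuous_on UNIV f" "Zn_periodic f"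
  obtains A where "A > 0" "\<And>x. \<bar>f x\<bar> \<le> A"
proof -
  obtain a where a: "\<And>y. f y \<le> f a" using Zn_periodic_attains_sup assms by blast
  obtain b where b: "\<And>y. f b \<le> f y" using Zn_periodic_attains_inf assms by blast
  have "\<bar>f x\<bar> \<le> \<bar>f a\<bar> + \<bar>f b\<bar> + 1" for x using a[of x] b[of x] by linarith
  then show ?thesis using that[of "\<bar>f a\<bar> + \<bar>f b\<bar> + 1"] by force
qed

lemma Zn_periodic_uniformly_continuous:
  fixes f :: "real ^ 'n \<Rightarrow> real"
  assumes "continuous_on UNIV f" "Zn_periodic f" "e > 0"
  obtains d where "d > 0" "\<And>x y. dist x y < d \<Longrightarrow> dist (f x) (f y) < e"
proof -
  \<comment> \<open>Moving \<open>x\<close> into the cube may leave a nearby \<open>y\<close>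
    outside it, so the cube is enlarged by the unit ball.\<close>
  define S where "S = (\<lambda>z. fst z + snd z) ` (cbox (0 :: real ^ 'n) (vec 1) \<times> cball 0 1)"
  have S_I: "frac_vector x + z \<in> S" if "norm z \<le> 1" for x z
    unfolding S_def using that frac_vector_in_unit_cube
    by (intro image_eqI[where x = "(frac_vector x, z)"]) auto
  have "compact S"
    unfolding S_def by (intro compact_continuous_image continuous_intros compact_Times) auto
  moreover have "continuous_on S f"
    using assms(1) continuous_on_subset by blast
  ultimately have "uniformly_continuous_on S f" by (rule compact_uniformly_continuous[rotated])
  then obtain d where d: "d > 0" "\<forall>x\<in>S. \<forall>y\<in>S. dist y x < d \<longrightarrow> dist (f y) (f x) < e"
    unfolding uniformly_continuous_on_def using \<open>e > 0\<close> by blast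
  have "dist (f x) (f y) < e" if "dist x y < min d 1" for x y
  proof -
    have "frac_vector x \<in> S" using S_I[of 0 x] by simp
    moreover have "frac_vector x + (y - x) \<in> S"
      using that by (intro S_I) (simp add: dist_norm norm_minus_commute)
    moreover have "dist (frac_vector x) (frac_vector x + (y - x)) < d"
      using that by (simp add: dist_norm norm_minus_commute)
    ultimately have "dist (f (frac_vector x)) (f (frac_vector x + (y - x))) < e" using d(2) by blast
    then show ?thesis
      using Zn_periodic_frac_vector_add[OF assms(2), of x "y - x"] Zn_periodic_frac_vector[OF assms(2), of x]
      by simp
  qed
  then show ?thesis using that[of "min d 1"] d(1) by simp
qed

section \<open>Comparison and Lipschitz bounds\<close>

lemma viscosity_subsolutionD:
  assumes "viscosity_subsolution F c u" "C1_with_gradient \<phi> D\<phi>" "local_max_at (\<lambda>y. u y - \<phi> y) x"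
  shows "F (D\<phi> x) x \<le> c"
  using assms unfolding viscosity_subsolution_def by blast

lemma viscosity_supersolutionD:
  assumes "viscosity_supersolution F c u" "C1_with_gradient \<phi> D\<phi>" "local_min_at (\<lambda>y. u y - \<phi> y) x"
  shows "c \<le> F (D\<phi> x) x"
  using assms unfolding viscosity_supersolution_def by blast

text \<open>Doubling of variables. The penalization forces the two touching points together, and both
  test functions have the same gradient there, so \<open>H\<close> cancels and only the oscillation of
  \<open>V\<close> is left.\<close>

lemma cell_problem_comparison:
  fixes u v V :: "real ^ 'n \<Rightarrow> real"
  assumes u: "continuous_on UNIV u" "Zn_periodic u"
    and v: "continuous_on UNIV v" "Zn_periodic v"
    and V: "continuous_on UNIV V" "Zn_periodic V"
    and sub: "viscosity_subsolution (\<lambda>q x. G q + V x) c1 u"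
    and super: "viscosity_supersolution (\<lambda>q x. G q + V x) c2 v"
  shows "c2 \<le> c1"
proof (rule field_le_epsilon)
  fix e :: real assume "e > 0"
  obtain A where A: "A > 0" "\<And>x. \<bar>u x\<bar> \<le> A" using Zn_periodic_bounded u by blast
  obtain B where B: "B > 0" "\<And>x. \<bar>v x\<bar> \<le> B" using Zn_periodic_bounded v by blast
  define K where "K = cbox (0 :: real ^ 'n) (vec 1) \<times> cball (0 :: real ^ 'n) 1"
  have compK: "compact K" unfolding K_def by (intro compact_Times) auto
  obtain d where d: "d > 0" "\<And>x y. dist x y < d \<Longrightarrow> dist (V x) (V y) < e"
    using Zn_periodic_uniformly_continuous[OF V \<open>e > 0\<close>] by blast
  \<comment> \<open>Two demands on the penalty: \<open>k \<ge> 2 * (A + B)\<close> makes offsets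
    longer than 1 no better than the diagonal, so a maximum over \<open>K\<close> is global, and
    \<open>k * d\<^sup>2 > 2 * (A + B)\<close> forces the optimal offset below \<open>d\<close>,
    where \<open>V\<close> varies by less than \<open>e\<close>.\<close>
  define k where "k = 2 * (A + B) * (1 + 2 / d\<^sup>2)"
  have k1: "k \<ge> 2 * (A + B)" and kd: "k * d\<^sup>2 > 2 * (A + B)" and k0: "k > 0"
  proof -
    have pos: "2 * (A + B) > 0" using A(1) B(1) by simp
    have "k = 2 * (A + B) + 2 * (A + B) * (2 / d\<^sup>2)" by (simp add: k_def distrib_left)
    moreover have "2 * (A + B) * (2 / d\<^sup>2) > 0" using pos d(1) by simp
    ultimately show "k \<ge> 2 * (A + B)" "k > 0" using pos by linarith+
    have "k * d\<^sup>2 = 2 * (A + B) * (d\<^sup>2 + 2)" using d(1) by (simp add: k_def field_simps)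
    also have "\<dots> > 2 * (A + B) * 1" using pos
      by (intro mult_strict_left_mono) (use zero_le_power2[of d] in linarith)+
    finally show "k * d\<^sup>2 > 2 * (A + B)" by simp
  qed
  \<comment> \<open>The second point is written as \<open>x + z\<close>, so that a common lattice
    translation changes \<open>x\<close> alone and \<open>x\<close> can be confined to the
    cube.\<close>
  define \<Phi> where "\<Phi> = (\<lambda>(x, z). u x - v (x + z) - k * (norm (z :: real ^ 'n))\<^sup>2)"
  have "continuous_on UNIV \<Phi>"
    unfolding \<Phi>_def case_prod_beta
    by (intro continuous_intros continuous_on_compose2[OF u(1)] continuous_on_compose2[OF v(1)]) auto
  then have "continuous_on K \<Phi>" using continuous_on_subset by blast
  moreover have K0: "(frac_vector x, 0) \<in> K" for x
    using frac_vector_in_unit_cube by (auto simp: K_def)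
  ultimately obtain w where w: "w \<in> K" "\<And>w'. w' \<in> K \<Longrightarrow> \<Phi> w' \<le> \<Phi> w"
    using continuous_attains_sup[OF compK, of \<Phi>] by blast
  obtain x0 z0 where xz: "w = (x0, z0)" by (cases w)
  have lower: "- (A + B) \<le> \<Phi> w"
    using w(2)[OF K0[of 0]] A(2)[of "frac_vector 0"] B(2)[of "frac_vector 0"]
    by (simp add: \<Phi>_def)
  have global: "\<Phi> (x, z) \<le> \<Phi> w" for x z
  proof (cases "norm z \<le> 1")
    case True
    have "\<Phi> (x, z) = \<Phi> (frac_vector x, z)"
      by (simp add: \<Phi>_def Zn_periodic_frac_vector[OF u(2)] Zn_periodic_frac_vector_add[OF v(2)])
    also have "\<dots> \<le> \<Phi> w"
      using True frac_vector_in_unit_cube by (intro w(2)) (auto simp: K_def)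
    finally show ?thesis .
  next
    case False
    then have "1 \<le> (norm z)\<^sup>2" by (intro one_le_power) simp
    then have "k \<le> k * (norm z)\<^sup>2" using k0 by simp
    then have "\<Phi> (x, z) \<le> - (A + B)"
      using k1 A(2)[of x] B(2)[of "x + z"] by (simp add: \<Phi>_def)
    then show ?thesis using lower by linarith
  qed
  define y0 where "y0 = x0 + z0"
  have touch: "u x - v y - k * (norm (y - x))\<^sup>2 \<le> u x0 - v y0 - k * (norm (y0 - x0))\<^sup>2" for x y
    using global[of x "y - x"] by (simp add: \<Phi>_def xz y0_def)
  have "k * (norm z0)\<^sup>2 \<le> 2 * (A + B)"
    using lower A(2)[of x0] B(2)[of "x0 + z0"] by (simp add: \<Phi>_def xz)
  then have "k * (norm z0)\<^sup>2 < k * d\<^sup>2" using kd by linarith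
  then have "norm z0 < d"
    using k0 \<open>d > 0\<close> by (simp add: power_less_imp_less_base)
  then have "dist (V y0) (V x0) < e" by (intro d(2)) (simp add: y0_def dist_norm)
  then have V_close: "V y0 - V x0 \<le> e" by (simp add: dist_real_def)
  have "G (k *\<^sub>R (2 *\<^sub>R (x0 - y0))) + V x0 \<le> c1"
  proof (rule viscosity_subsolutionD[OF sub C1_scale[OF C1_norm_square]])
    show "local_max_at (\<lambda>x. u x - k * (norm (x - y0))\<^sup>2) x0"
      by (rule local_max_at_global) (use touch[of _ y0] in \<open>simp add: norm_minus_commute\<close>)
  qed
  moreover have "c2 \<le> G (- (k *\<^sub>R (2 *\<^sub>R (y0 - x0)))) + V y0"
  proof (rule viscosity_supersolutionD[OF super C1_minus[OF C1_scale[OF C1_norm_square]]])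
    show "local_min_at (\<lambda>y. v y - - (k * (norm (y - x0))\<^sup>2)) y0"
      by (rule local_min_at_global) (use touch[of x0] in \<open>simp add: algebra_simps\<close>)
  qed
  moreover have "- (k *\<^sub>R (2 *\<^sub>R (y0 - x0))) = k *\<^sub>R (2 *\<^sub>R (x0 - y0))"
    by (simp add: algebra_simps)
  ultimately show "c2 \<le> c1 + e" using V_close by simp
qed

text \<open>Touching \<open>u\<close> from above by the smoothed cone with slope \<open>K > R\<close> is possible only within
  distance \<open>O(s)\<close> of the vertex.\<close>

lemma Lipschitz_if_gradients_bounded:
  fixes u :: "real ^ 'n \<Rightarrow> real"
  assumes cont: "continuous_on UNIV u" and bound: "\<And>y. u y \<le> B" and R: "R \<ge> 0"
    and grad: "\<And>\<phi> D\<phi> x. C1_with_gradient \<phi> D\<phi> \<Longrightarrow> local_max_at (\<lambda>y. u y - \<phi> y) x \<Longrightarrow> norm (D\<phi> x) \<le> R"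
  shows "\<bar>u y - u x\<bar> \<le> (R + 1) * norm (y - x)"
proof -
  have *: "u y - u a \<le> (R + 1) * norm (y - a)" for a y
  proof (rule field_le_epsilon)
    fix e :: real assume "e > 0"
    \<comment> \<open>The excess 1 over \<open>R\<close> pins down the contact point:
      \<open>K * norm (z - a) \<le> R * r z\<close> and \<open>r z \<le> norm (z - a) + s\<close>
      leave \<open>norm (z - a) \<le> R * s\<close>.\<close>
    define K where "K = R + 1"
    have "isCont u a" using cont by (simp add: continuous_on_eq_continuous_at)
    then obtain d where d: "d > 0" "\<And>x. dist x a < d \<Longrightarrow> dist (u x) (u a) < e / 2"
      using \<open>e > 0\<close> unfolding continuous_at_eps_delta by (metis half_gt_zero)
    \<comment> \<open>The first bound puts the contact point where \<open>u\<close> differs from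
      \<open>u a\<close> by less than \<open>e / 2\<close>; the second lets the other half of
      \<open>e\<close> pay for the rounding of the cone.\<close>
    define s where "s = min (d / (2 * K)) (e / (2 * K))"
    have s: "s > 0" "s * K < d" "K * s \<le> e / 2"
    proof -
      have K0: "K > 0" using R by (simp add: K_def)
      then show "s > 0" using d(1) \<open>e > 0\<close> by (simp add: s_def)
      have "s * K \<le> (d / (2 * K)) * K" using K0 by (intro mult_right_mono) (auto simp: s_def)
      also have "\<dots> < d" using K0 d(1) by simp
      finally show "s * K < d" .
      have "K * s \<le> K * (e / (2 * K))" using K0 by (intro mult_left_mono) (auto simp: s_def)
      then show "K * s \<le> e / 2" using K0 by simp
    qed
    define r where "r = (\<lambda>y. sqrt ((norm (y - a))\<^sup>2 + s\<^sup>2))"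
    have C1: "C1_with_gradient (\<lambda>y. K * r y) (\<lambda>y. (K / r y) *\<^sub>R (y - a))"
      unfolding r_def by (rule C1_smoothed_cone[OF s(1)])
    have "filterlim (\<lambda>y. K * r y) at_top at_infinity"
      unfolding r_def using R by (intro filterlim_smoothed_cone) (simp add: K_def)
    then obtain z where z: "\<And>y. u y - K * r y \<le> u z - K * r z"
      using bounded_above_minus_coercive_attains_sup[OF cont C1_imp_continuous[OF C1] bound] by blast
    have r0: "r z > 0" using s(1) by (simp add: r_def add_nonneg_pos)
    have "norm ((K / r z) *\<^sub>R (z - a)) \<le> R"
      by (rule grad[OF C1 local_max_at_global]) (rule z)
    then have "(K / r z) * norm (z - a) \<le> R" using r0 R by (simp only: norm_scaleR) (simp add: K_def)
    then have "K * norm (z - a) \<le> R * r z" using r0 by (simp add: pos_divide_le_eq)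
    moreover have "r z \<le> norm (z - a) + s"
      unfolding r_def using sqrt_sum_squares_le_sum[of "norm (z - a)" s] s(1) by simp
    then have "R * r z \<le> R * norm (z - a) + R * s"
      using mult_left_mono[of "r z" "norm (z - a) + s" R] R by (simp add: distrib_left)
    ultimately have "norm (z - a) \<le> R * s" by (simp add: K_def algebra_simps)
    also have "\<dots> \<le> s * K" using s(1) by (simp add: K_def algebra_simps)
    finally have "dist z a < d" using s(2) by (simp add: dist_norm)
    then have "dist (u z) (u a) < e / 2" by (rule d(2))
    then have "u z \<le> u a + e / 2" unfolding dist_real_def by linarith
    moreover have "u y - K * r y \<le> u z" 
    proof -
      have "0 \<le> K * r z" using r0 R by (simp add: K_def)
      then show ?thesis using z[of y] by linarith
    qed
    moreover have "r y \<le> norm (y - a) + s"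
      unfolding r_def using sqrt_sum_squares_le_sum[of "norm (y - a)" s] s(1) by simp
    then have "K * r y \<le> K * norm (y - a) + K * s"
      using mult_left_mono[of "r y" "norm (y - a) + s" K] R by (simp add: K_def distrib_left)
    ultimately show "u y - u a \<le> (R + 1) * norm (y - a) + e"
      using s(3) unfolding K_def by linarith
  qed
  show ?thesis using *[of y x] *[of x y] by (simp add: norm_minus_commute abs_le_iff)
qed

section \<open>Stability and bumps\<close>

text \<open>Stability, in a form that serves both the supremum of a family of subsolutions and locally
  uniform limits: the test function is made strict by adding \<open>|y - x|\<^sup>2\<close>, so that the maximum
  points for the approximations converge to \<open>x\<close>.\<close>

lemma subsolution_limit:
  fixes u :: "nat \<Rightarrow> real ^ 'n \<Rightarrow> real"
  assumes u_cont: "\<And>n. continuous_on UNIV (u n)" and w_cont: "continuous_on UNIV w"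
    and sub: "\<And>n. viscosity_subsolution (F n) c (u n)"
    and upper: "\<And>n y. u n y \<le> w y + eps n" and eps: "eps \<longlonglongrightarrow> 0"
    and at_x: "(\<lambda>n. u n x) \<longlonglongrightarrow> w x"
    and F: "\<And>q y. q \<longlonglongrightarrow> D\<phi> x \<Longrightarrow> y \<longlonglongrightarrow> x \<Longrightarrow> (\<lambda>n. u n (y n)) \<longlonglongrightarrow> w x \<Longrightarrow>
              (\<lambda>n. F n (q n) (y n)) \<longlonglongrightarrow> l"
    and C1: "C1_with_gradient \<phi> D\<phi>" and lmax: "local_max_at (\<lambda>y. w y - \<phi> y) x"
  shows "l \<le> c"
proof -
  obtain r' where r': "r' > 0" "\<And>y. dist y x < r' \<Longrightarrow> w y - \<phi> y \<le> w x - \<phi> x"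
    using lmax unfolding local_max_at_def eventually_nhds_metric by blast
  define r where "r = r' / 2"
  have r: "r > 0" "\<And>y. dist y x \<le> r \<Longrightarrow> w y - \<phi> y \<le> w x - \<phi> x"
    using r' by (auto simp: r_def)
  define \<psi> where "\<psi> = (\<lambda>y. \<phi> y + (norm (y - x))\<^sup>2)"
  have \<psi>: "C1_with_gradient \<psi> (\<lambda>y. D\<phi> y + 2 *\<^sub>R (y - x))"
    unfolding \<psi>_def by (rule C1_add[OF C1 C1_norm_square])
  define P where "P = (\<lambda>n z. z \<in> cball x r \<and> (\<forall>y\<in>cball x r. u n y - \<psi> y \<le> u n z - \<psi> z))"
  have "\<exists>z. P n z" for n
  proof -
    have "continuous_on UNIV (\<lambda>y. u n y - \<psi> y)"
      using u_cont C1_imp_continuous[OF \<psi>] by (intro continuous_on_diff)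
    then have "continuous_on (cball x r) (\<lambda>y. u n y - \<psi> y)"
      using continuous_on_subset by blast
    then show ?thesis
      using continuous_attains_sup[of "cball x r" "\<lambda>y. u n y - \<psi> y"] r(1)
      unfolding P_def by (simp add: Bex_def)
  qed
  then obtain y where "\<And>n. P n (y n)" using choice[of P] by blast
  then have y: "\<And>n. y n \<in> cball x r"
    "\<And>n z. z \<in> cball x r \<Longrightarrow> u n z - \<psi> z \<le> u n (y n) - \<psi> (y n)"
    unfolding P_def by blast+
  have est: "u n x - \<phi> x \<le> u n (y n) - \<phi> (y n) - (norm (y n - x))\<^sup>2" for n
    using y(2)[of x n] r(1) by (simp add: \<psi>_def)
  \<comment> \<open>Combining \<open>est\<close> with the maximality of \<open>w - \<phi>\<close> at
    \<open>x\<close> leaves only the added square, which is therefore bounded by the approximation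
    error at \<open>x\<close>.\<close>
  have near: "(norm (y n - x))\<^sup>2 \<le> w x - u n x + eps n" for n
    using est[of n] upper[of n "y n"] r(2)[of "y n"] y(1)[of n] by (simp add: dist_commute)
  have "(\<lambda>n. w x - u n x + eps n) \<longlonglongrightarrow> w x - w x + 0"
    by (rule tendsto_add[OF tendsto_diff[OF tendsto_const at_x] eps])
  then have near_lim: "(\<lambda>n. w x - u n x + eps n) \<longlonglongrightarrow> 0" by simp
  have "(\<lambda>n. (norm (y n - x))\<^sup>2) \<longlonglongrightarrow> 0"
    by (rule tendsto_sandwich[OF _ _ tendsto_const near_lim]) (simp_all add: near)
  then have "(\<lambda>n. sqrt ((norm (y n - x))\<^sup>2)) \<longlonglongrightarrow> sqrt 0" by (rule tendsto_real_sqrt)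
  then have "(\<lambda>n. y n - x) \<longlonglongrightarrow> 0" by (rule_tac tendsto_norm_zero_cancel) simp
  then have y_lim: "y \<longlonglongrightarrow> x" by (rule LIM_zero_cancel)
  have lim: "(\<lambda>n. f (y n)) \<longlonglongrightarrow> f x" if "continuous_on UNIV f" for f :: "real ^ 'n \<Rightarrow> 'b::topological_space"
    by (rule isCont_tendsto_compose[OF _ y_lim])
      (use that in \<open>simp add: continuous_on_eq_continuous_at\<close>)
  \<comment> \<open>Convergence at the moving points is needed because the operators
    \<open>F n\<close> may contain a zeroth-order term in \<open>u n\<close>.\<close>
  have u_lim: "(\<lambda>n. u n (y n)) \<longlonglongrightarrow> w x"
  proof (rule tendsto_sandwich)
    have "(\<lambda>n. u n x - \<phi> x + \<phi> (y n)) \<longlonglongrightarrow> w x - \<phi> x + \<phi> x"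
      by (rule tendsto_add[OF tendsto_diff[OF at_x tendsto_const] lim[OF C1_imp_continuous[OF C1]]])
    then show "(\<lambda>n. u n x - \<phi> x + \<phi> (y n)) \<longlonglongrightarrow> w x" by simp
    have "(\<lambda>n. w (y n) + eps n) \<longlonglongrightarrow> w x + 0"
      by (rule tendsto_add[OF lim[OF w_cont] eps])
    then show "(\<lambda>n. w (y n) + eps n) \<longlonglongrightarrow> w x" by simp
    have "u n x - \<phi> x + \<phi> (y n) \<le> u n (y n)" for n
      using est[of n] zero_le_power2[of "norm (y n - x)"] by linarith
    then show "\<forall>\<^sub>F n in sequentially. u n x - \<phi> x + \<phi> (y n) \<le> u n (y n)" by simp
    show "\<forall>\<^sub>F n in sequentially. u n (y n) \<le> w (y n) + eps n" using upper by simp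
  qed
  have "continuous_on UNIV (\<lambda>y. D\<phi> y + 2 *\<^sub>R (y - x))"
    using \<psi> by (simp add: C1_with_gradient_def)
  from lim[OF this] have "(\<lambda>n. D\<phi> (y n) + 2 *\<^sub>R (y n - x)) \<longlonglongrightarrow> D\<phi> x" by simp
  then have "(\<lambda>n. F n (D\<phi> (y n) + 2 *\<^sub>R (y n - x)) (y n)) \<longlonglongrightarrow> l"
    by (rule F) (rule y_lim, rule u_lim)
  moreover have "\<forall>\<^sub>F n in sequentially. F n (D\<phi> (y n) + 2 *\<^sub>R (y n - x)) (y n) \<le> c"
  proof -
    have "\<forall>\<^sub>F n in sequentially. dist (y n) x < r"
      using y_lim r(1) by (rule tendstoD)
    then show ?thesis
    proof eventually_elim
      case (elim n)
      then have "y n \<in> ball x r" by (simp add: dist_commute)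
      then have "\<forall>\<^sub>F z in nhds (y n). z \<in> ball x r"
        by (intro eventually_nhds_in_open) auto
      then have "local_max_at (\<lambda>z. u n z - \<psi> z) (y n)"
        unfolding local_max_at_def
      proof eventually_elim
        case (elim z)
        then show ?case using y(2)[of z n] by simp
      qed
      then show ?case by (rule viscosity_subsolutionD[OF sub[of n] \<psi>])
    qed
  qed
  ultimately show ?thesis by (rule tendsto_upperbound) simp
qed

text \<open>Reflection turns contact from below into contact from above and reverses the test
  gradient, hence the two signs in the operator. Stability then has to be proved on one side
  only.\<close>

lemma viscosity_supersolution_uminus:
  assumes "viscosity_supersolution F c u"
  shows "viscosity_subsolution (\<lambda>q x. - F (- q) x) (- c) (\<lambda>x. - u x)"
  unfolding viscosity_subsolution_def
proof (intro allI impI)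
  fix \<phi> D\<phi> x assume *: "C1_with_gradient \<phi> D\<phi> \<and> local_max_at (\<lambda>y. - u y - \<phi> y) x"
  then have "local_min_at (\<lambda>y. u y - - \<phi> y) x"
    unfolding local_max_at_def local_min_at_def by (elim conjE eventually_mono) simp
  then have "c \<le> F (- D\<phi> x) x"
    using viscosity_supersolutionD[OF assms C1_minus] * by blast
  then show "- F (- D\<phi> x) x \<le> - c" by simp
qed

lemma supersolution_limit:
  fixes u :: "nat \<Rightarrow> real ^ 'n \<Rightarrow> real"
  assumes u_cont: "\<And>n. continuous_on UNIV (u n)" and w_cont: "continuous_on UNIV w"
    and super: "\<And>n. viscosity_supersolution (F n) c (u n)"
    and lower: "\<And>n y. w y - eps n \<le> u n y" and eps: "eps \<longlonglongrightarrow> 0"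
    and at_x: "(\<lambda>n. u n x) \<longlonglongrightarrow> w x"
    and F: "\<And>q y. q \<longlonglongrightarrow> D\<phi> x \<Longrightarrow> y \<longlonglongrightarrow> x \<Longrightarrow> (\<lambda>n. u n (y n)) \<longlonglongrightarrow> w x \<Longrightarrow>
              (\<lambda>n. F n (q n) (y n)) \<longlonglongrightarrow> l"
    and C1: "C1_with_gradient \<phi> D\<phi>" and lmin: "local_min_at (\<lambda>y. w y - \<phi> y) x"
  shows "c \<le> l"
proof -
  have "- l \<le> - c"
  proof (rule subsolution_limit[where u = "\<lambda>n y. - u n y" and w = "\<lambda>y. - w y" and eps = eps
        and F = "\<lambda>n q x. - F n (- q) x" and x = x and \<phi> = "\<lambda>y. - \<phi> y" and D\<phi> = "\<lambda>y. - D\<phi> y"])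
    show "viscosity_subsolution (\<lambda>q x. - F n (- q) x) (- c) (\<lambda>y. - u n y)" for n
      by (rule viscosity_supersolution_uminus[OF super])
    show "C1_with_gradient (\<lambda>y. - \<phi> y) (\<lambda>y. - D\<phi> y)" by (rule C1_minus[OF C1])
    show "local_max_at (\<lambda>y. - w y - - \<phi> y) x"
      using lmin unfolding local_max_at_def local_min_at_def by eventually_elim simp
    show "(\<lambda>n. - u n x) \<longlonglongrightarrow> - w x" using at_x by (rule tendsto_minus)
    show "(\<lambda>n. - F n (- q n) (y n)) \<longlonglongrightarrow> - l"
      if "q \<longlonglongrightarrow> - D\<phi> x" "y \<longlonglongrightarrow> x" "(\<lambda>n. - u n (y n)) \<longlonglongrightarrow> - w x" for q y
    proof (intro tendsto_minus F)
      show "(\<lambda>n. - q n) \<longlonglongrightarrow> D\<phi> x" using tendsto_minus[OF that(1)] by simp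
      show "(\<lambda>n. u n (y n)) \<longlonglongrightarrow> w x" using tendsto_minus[OF that(3)] by simp
    qed (rule that)
    show "- u n y \<le> - w y + eps n" for n y using lower[of y n] by simp
  qed (use u_cont w_cont eps in \<open>auto intro: continuous_on_minus\<close>)
  then show ?thesis by simp
qed

text \<open>The local improvement in Perron's method. Where \<open>u = w\<close>, a test function
  touching \<open>u\<close> from above touches \<open>w\<close> as well, because
  \<open>w \<le> u\<close>. Elsewhere \<open>u = \<theta>\<close>, and \<open>boundary\<close> puts
  the point strictly inside the ball, so the test gradient is that of \<open>\<theta>\<close> and
  \<open>strict\<close> applies.\<close>

lemma subsolution_bump:
  fixes w \<theta> :: "real ^ 'n \<Rightarrow> real"
  assumes w_cont: "continuous_on UNIV w"
    and sub: "viscosity_subsolution (\<lambda>q x. K q x + \<delta> * w x) 0 w"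
    and C1: "C1_with_gradient \<theta> D\<theta>"
    and strict: "\<And>y. dist y x0 \<le> r \<Longrightarrow> K (D\<theta> y) y + \<delta> * \<theta> y \<le> 0"
    and boundary: "\<And>y. dist y x0 = r \<Longrightarrow> \<theta> y \<le> w y"
  defines "u \<equiv> \<lambda>y. if dist y x0 \<le> r then max (w y) (\<theta> y) else w y"
  shows "continuous_on UNIV u" "viscosity_subsolution (\<lambda>q x. K q x + \<delta> * u x) 0 u"
proof -
  have "continuous_on UNIV (\<lambda>y. max (w y) (\<theta> y))"
    using w_cont C1_imp_continuous[OF C1] by (rule continuous_on_max)
  then show "continuous_on UNIV u"
    unfolding u_def
    by (intro continuous_on_cases_le continuous_on_dist continuous_on_id continuous_on_const)
      (use w_cont boundary in \<open>auto intro: continuous_on_subset simp: max_absorb1\<close>)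
  have ge: "w y \<le> u y" for y by (simp add: u_def)
  show "viscosity_subsolution (\<lambda>q x. K q x + \<delta> * u x) 0 u"
    unfolding viscosity_subsolution_def
  proof (intro allI impI)
    fix \<phi> D\<phi> x assume *: "C1_with_gradient \<phi> D\<phi> \<and> local_max_at (\<lambda>y. u y - \<phi> y) x"
    show "K (D\<phi> x) x + \<delta> * u x \<le> 0"
    proof (cases "u x = w x")
      case True
      have "\<forall>\<^sub>F y in nhds x. u y - \<phi> y \<le> u x - \<phi> x"
        using * by (simp add: local_max_at_def)
      then have "\<forall>\<^sub>F y in nhds x. w y - \<phi> y \<le> w x - \<phi> x"
      proof eventually_elim
        case (elim y)
        then show ?case using ge[of y] True by linarith
      qed
      then show ?thesis
        using viscosity_subsolutionD[OF sub, of \<phi> D\<phi> x] * True by (simp add: local_max_at_def)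
    next
      case False
      then have x_in: "dist x x0 \<le> r" and ux: "u x = \<theta> x"
        by (auto simp: u_def max_def split: if_splits)
      moreover have "dist x x0 \<noteq> r"
        using False boundary[of x] by (auto simp: u_def)
      ultimately have "x \<in> ball x0 r" by (simp add: dist_commute)
      then have "\<forall>\<^sub>F y in nhds x. y \<in> ball x0 r"
        by (intro eventually_nhds_in_open) auto
      moreover have "\<forall>\<^sub>F y in nhds x. u y - \<phi> y \<le> u x - \<phi> x"
        using * by (simp add: local_max_at_def)
      ultimately have "\<forall>\<^sub>F y in nhds x. \<theta> y - \<phi> y \<le> \<theta> x - \<phi> x"
      proof eventually_elim
        case (elim y)
        then have "\<theta> y \<le> u y" by (simp add: u_def dist_commute)
        then show ?case using elim ux by linarith
      qed
      then have "D\<theta> x = D\<phi> x"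
        using C1 * unfolding C1_with_gradient_def
        by (intro gradient_eq_at_local_max[of \<theta> x _ \<phi>]) (auto simp: local_max_at_def)
      then show ?thesis using strict[OF x_in] ux by simp
    qed
  qed
qed

section \<open>Perron's method for the discounted problem\<close>

lemma viscosity_subsolution_translation:
  assumes sub: "viscosity_subsolution F c u" and F: "\<And>q x. F q (x + m) = F' q x"
  shows "viscosity_subsolution F' c (\<lambda>x. u (x + m))"
  unfolding viscosity_subsolution_def
proof (intro allI impI)
  fix \<phi> D\<phi> x assume *: "C1_with_gradient \<phi> D\<phi> \<and> local_max_at (\<lambda>y. u (y + m) - \<phi> y) x"
  have "C1_with_gradient (\<lambda>y. \<phi> (y + - m)) (\<lambda>y. D\<phi> (y + - m))"
    using * by (blast intro: C1_translation)
  moreover have "local_max_at (\<lambda>y. u y - \<phi> (y + - m)) (x + m)"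
  proof -
    obtain d where d: "d > 0" "\<And>y. dist y x < d \<Longrightarrow> u (y + m) - \<phi> y \<le> u (x + m) - \<phi> x"
      using * unfolding local_max_at_def eventually_nhds_metric by blast
    have "u y - \<phi> (y + - m) \<le> u (x + m) - \<phi> (x + m + - m)" if "dist y (x + m) < d" for y
    proof -
      have "dist (y - m) x < d" using that by (simp add: dist_norm algebra_simps)
      from d(2)[OF this] show ?thesis by simp
    qed
    then show ?thesis unfolding local_max_at_def eventually_nhds_metric using d(1) by blast
  qed
  ultimately have "F (D\<phi> (x + m + - m)) (x + m) \<le> c" by (rule viscosity_subsolutionD[OF sub])
  then show "F' (D\<phi> x) x \<le> c" by (simp add: F)
qed

lemma Lipschitz_imp_continuous_on:
  fixes f :: "'a::real_normed_vector \<Rightarrow> real"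
  assumes "\<And>x y. \<bar>f y - f x\<bar> \<le> L * norm (y - x)" "L \<ge> 0"
  shows "continuous_on S f"
proof -
  have "L-lipschitz_on S f"
    using assms by (intro lipschitz_onI) (auto simp: dist_norm)
  then show ?thesis by (rule lipschitz_on_continuous_on)
qed

text \<open>Perron's method for \<open>G (Dw) + V + \<delta> w = 0\<close>, with the zeroth-order term put into the
  operator so that the definitions above apply. The admissible subsolutions are not required to be
  periodic: periodicity of the supremum follows from translation invariance of the class, and the
  bump need not be periodized.\<close>

context
  fixes G V :: "real ^ 'n \<Rightarrow> real" and \<delta> M R :: real
  assumes G_cont: "continuous_on UNIV G" and V_cont: "continuous_on UNIV V"
    and V_per: "Zn_periodic V" and \<delta>: "\<delta> > 0" and R: "R \<ge> 0"
    and M: "\<And>q x. norm q \<le> 1 \<Longrightarrow> \<bar>G q + V x\<bar> \<le> M"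
    and coercivity: "\<And>q x. G q + V x \<le> M \<Longrightarrow> norm q \<le> R"
begin

text \<open>The lower bound is built in because it turns the subsolution inequality into
  \<open>G + V \<le> - \<delta> * u \<le> M\<close> at contact points; coercivity then gives one
  Lipschitz constant for the whole class, and the supremum is continuous without semicontinuous
  envelopes. The unspecified upper bound only secures contact points; a uniform one follows from
  it.\<close>

definition discounted_subsolutions :: "(real ^ 'n \<Rightarrow> real) set" where
  "discounted_subsolutions = {u. continuous_on UNIV u \<and> (\<exists>B. \<forall>x. u x \<le> B) \<and> (\<forall>x. - M \<le> \<delta> * u x) \<and>
     viscosity_subsolution (\<lambda>q x. G q + V x + \<delta> * u x) 0 u}"

lemma constant_in_discounted_subsolutions: "(\<lambda>x. - M / \<delta>) \<in> discounted_subsolutions"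
proof -
  have "viscosity_subsolution (\<lambda>q x. G q + V x + \<delta> * (- M / \<delta>)) 0 (\<lambda>x. - M / \<delta>)"
    unfolding viscosity_subsolution_def
  proof (intro allI impI)
    fix \<phi> D\<phi> x assume *: "C1_with_gradient \<phi> D\<phi> \<and> local_max_at (\<lambda>y. - M / \<delta> - \<phi> y) (x :: real ^ 'n)"
    then have "0 = D\<phi> x"
      unfolding C1_with_gradient_def
      by (intro gradient_eq_at_local_max[of "\<lambda>_. - M / \<delta>" x 0 \<phi>]) (auto simp: GDERIV_const)
    then show "G (D\<phi> x) + V x + \<delta> * (- M / \<delta>) \<le> 0" using M[of 0 x] \<delta> by simp
  qed
  then show ?thesis using \<delta> by (auto simp: discounted_subsolutions_def)
qed

text \<open>At a maximum point of \<open>u\<close> the test gradient 0 would suffice, but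
  \<open>u\<close> need not attain its supremum. Subtracting a rounded cone of slope
  \<open>k \<le> 1\<close> produces a contact point, which is why \<open>M\<close> has to control
  gradients up to norm 1. The price at \<open>z\<close> is
  \<open>k * (\<delta> * r z) \<le> e\<close>.\<close>

lemma discounted_subsolution_upper_bound:
  assumes "u \<in> discounted_subsolutions"
  shows "\<delta> * u z \<le> M"
proof (rule field_le_epsilon)
  fix e :: real assume "e > 0"
  obtain B where B: "\<And>x. u x \<le> B" and u: "continuous_on UNIV u"
    and sub: "viscosity_subsolution (\<lambda>q x. G q + V x + \<delta> * u x) 0 u"
    using assms unfolding discounted_subsolutions_def by blast
  define r where "r = (\<lambda>y :: real ^ 'n. sqrt ((norm (y - 0))\<^sup>2 + 1\<^sup>2))"
  have r1: "r y \<ge> 1" for y by (simp add: r_def)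
  define k where "k = min 1 (e / (\<delta> * r z))"
  have rz: "\<delta> * r z > 0" using r1[of z] \<delta> by simp
  then have k: "k > 0" "k \<le> 1" using \<open>e > 0\<close> by (auto simp: k_def)
  have "k \<le> e / (\<delta> * r z)" by (simp add: k_def)
  then have k_e: "k * (\<delta> * r z) \<le> e" using rz by (simp add: pos_le_divide_eq)
  have C1: "C1_with_gradient (\<lambda>y. k * r y) (\<lambda>y. (k / r y) *\<^sub>R (y - 0))"
    unfolding r_def by (rule C1_smoothed_cone) simp
  have "filterlim (\<lambda>y. k * r y) at_top at_infinity"
    unfolding r_def using k(1) by (rule filterlim_smoothed_cone)
  then obtain x where x: "\<And>y. u y - k * r y \<le> u x - k * r x"
    using bounded_above_minus_coercive_attains_sup[OF u C1_imp_continuous[OF C1] B] by blast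
  have "G ((k / r x) *\<^sub>R (x - 0)) + V x + \<delta> * u x \<le> 0"
    by (rule viscosity_subsolutionD[OF sub C1 local_max_at_global]) (rule x)
  moreover have "norm ((k / r x) *\<^sub>R (x - 0)) \<le> 1"
  proof -
    have "norm x \<le> r x" by (simp add: r_def real_le_rsqrt)
    then have "k * norm x \<le> 1 * r x" using k r1[of x] by (intro mult_mono) auto
    then show ?thesis using r1[of x] k(1) by (simp add: pos_divide_le_eq)
  qed
  ultimately have "\<delta> * u x \<le> M" using M[of "(k / r x) *\<^sub>R (x - 0)" x] by linarith
  moreover have "u z \<le> u x + k * r z"
  proof -
    have "0 \<le> k * r x" using k(1) r1[of x] by simp
    then show ?thesis using x[of z] by linarith
  qed
  then have "\<delta> * u z \<le> \<delta> * (u x + k * r z)" using \<delta> by (intro mult_left_mono) auto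
  then have "\<delta> * u z \<le> \<delta> * u x + k * (\<delta> * r z)" by (simp add: algebra_simps)
  ultimately show "\<delta> * u z \<le> M + e" using k_e by linarith
qed

lemma discounted_subsolution_Lipschitz:
  assumes "u \<in> discounted_subsolutions"
  shows "\<bar>u y - u x\<bar> \<le> (R + 1) * norm (y - x)"
proof -
  obtain B where B: "\<And>x. u x \<le> B" and u: "continuous_on UNIV u"
    and sub: "viscosity_subsolution (\<lambda>q x. G q + V x + \<delta> * u x) 0 u"
    and lower: "\<And>x. - M \<le> \<delta> * u x"
    using assms unfolding discounted_subsolutions_def by blast
  show ?thesis
  proof (rule Lipschitz_if_gradients_bounded[OF u B R])
    fix \<phi> D\<phi> x assume "C1_with_gradient \<phi> D\<phi>" "local_max_at (\<lambda>y. u y - \<phi> y) x"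
    then have "G (D\<phi> x) + V x + \<delta> * u x \<le> 0" by (rule viscosity_subsolutionD[OF sub])
    then show "norm (D\<phi> x) \<le> R" using lower[of x] by (intro coercivity[of _ x]) linarith
  qed
qed

definition perron :: "real ^ 'n \<Rightarrow> real" where
  "perron x = (SUP u\<in>discounted_subsolutions. u x)"

lemma perron_upper:
  assumes "u \<in> discounted_subsolutions"
  shows "u x \<le> perron x"
  unfolding perron_def
proof (rule cSUP_upper[OF assms])
  show "bdd_above ((\<lambda>u. u x) ` discounted_subsolutions)"
    using discounted_subsolution_upper_bound \<delta>
    by (intro bdd_aboveI[where M = "M / \<delta>"]) (auto simp: pos_le_divide_eq mult.commute)
qed

lemma perron_least:
  assumes "\<And>u. u \<in> discounted_subsolutions \<Longrightarrow> u x \<le> b"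
  shows "perron x \<le> b"
  unfolding perron_def using constant_in_discounted_subsolutions assms by (intro cSUP_least) auto

lemma perron_bounds: "\<bar>\<delta> * perron x\<bar> \<le> M"
proof -
  have "perron x \<le> M / \<delta>"
    using discounted_subsolution_upper_bound \<delta>
    by (intro perron_least) (auto simp: pos_le_divide_eq mult.commute)
  moreover have "- M / \<delta> \<le> perron x"
    using perron_upper[OF constant_in_discounted_subsolutions] by simp
  ultimately have "\<delta> * perron x \<le> M" "- M \<le> \<delta> * perron x"
    using mult_left_mono[of "perron x" "M / \<delta>" \<delta>] mult_left_mono[of "- M / \<delta>" "perron x" \<delta>] \<delta>
    by simp_all
  then show ?thesis by linarith
qed

lemma perron_Lipschitz: "\<bar>perron y - perron x\<bar> \<le> (R + 1) * norm (y - x)"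
proof -
  have *: "perron y \<le> perron x + (R + 1) * norm (y - x)" for x y
  proof (rule perron_least)
    fix u assume "u \<in> discounted_subsolutions"
    then show "u y \<le> perron x + (R + 1) * norm (y - x)"
      using discounted_subsolution_Lipschitz[of u y x] perron_upper[of u x] by linarith
  qed
  show ?thesis using *[of y x] *[of x y] by (simp add: norm_minus_commute abs_le_iff)
qed

lemma perron_continuous: "continuous_on UNIV perron"
  using perron_Lipschitz R by (intro Lipschitz_imp_continuous_on[of perron "R + 1"]) auto

lemma perron_periodic: "Zn_periodic perron"
proof -
  have le: "perron (x + m) \<le> perron x" if m: "m \<in> integer_vectors" for x m
  proof (rule perron_least)
    fix u assume u: "u \<in> discounted_subsolutions"
    have "(\<lambda>y. u (y + m)) \<in> discounted_subsolutions"
      unfolding discounted_subsolutions_def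
    proof (intro CollectI conjI)
      have "\<bar>u (z + m) - u (y + m)\<bar> \<le> (R + 1) * norm (z - y)" for y z
        using discounted_subsolution_Lipschitz[OF u, of "z + m" "y + m"] by simp
      then show "continuous_on UNIV (\<lambda>y. u (y + m))"
        using R by (intro Lipschitz_imp_continuous_on[where L = "R + 1"]) auto
      show "\<exists>B. \<forall>x. u (x + m) \<le> B" "\<forall>x. - M \<le> \<delta> * u (x + m)"
        using u unfolding discounted_subsolutions_def by blast+
      have "viscosity_subsolution (\<lambda>q x. G q + V x + \<delta> * u x) 0 u"
        using u unfolding discounted_subsolutions_def by blast
      then show "viscosity_subsolution (\<lambda>q x. G q + V x + \<delta> * u (x + m)) 0 (\<lambda>y. u (y + m))"
        by (rule viscosity_subsolution_translation) (use V_per m in \<open>simp add: Zn_periodic_def\<close>)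
    qed
    from perron_upper[OF this, of x] show "u (x + m) \<le> perron x" .
  qed
  show ?thesis
    unfolding Zn_periodic_def
  proof (intro allI ballI antisym)
    fix x m :: "real ^ 'n" assume "m \<in> integer_vectors"
    then show "perron (x + m) \<le> perron x" "perron x \<le> perron (x + m)"
      using le[of m x] le[of "- m" "x + m"] integer_vectors_uminus by auto
  qed
qed

text \<open>The approximating sequence depends on the point \<open>x\<close>. Convergence is needed
  there only, since elsewhere \<open>u n \<le> perron\<close> is all that
  \<open>subsolution_limit\<close> requires.\<close>

lemma perron_subsolution: "viscosity_subsolution (\<lambda>q x. G q + V x + \<delta> * perron x) 0 perron"
  unfolding viscosity_subsolution_def
proof (intro allI impI)
  fix \<phi> D\<phi> x assume *: "C1_with_gradient \<phi> D\<phi> \<and> local_max_at (\<lambda>y. perron y - \<phi> y) x"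
  define P where "P = (\<lambda>n u. u \<in> discounted_subsolutions \<and> perron x - 1 / Suc n < u x)"
  have "\<exists>u. P n u" for n
  proof (rule ccontr)
    assume "\<nexists>u. P n u"
    then have "u x \<le> perron x - 1 / Suc n" if "u \<in> discounted_subsolutions" for u
      using that unfolding P_def by (meson not_le)
    then have "perron x \<le> perron x - 1 / Suc n" by (rule perron_least)
    then show False by simp
  qed
  then obtain u where "\<And>n. P n (u n)" using choice[of P] by blast
  then have u: "u n \<in> discounted_subsolutions" and ux: "perron x - 1 / Suc n < u n x" for n
    unfolding P_def by blast+
  have "(\<lambda>n. 1 / real (Suc n)) \<longlonglongrightarrow> 0" using LIMSEQ_inverse_real_of_nat by (simp add: inverse_eq_divide)
  from tendsto_diff[OF tendsto_const this, of "perron x"]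
  have low: "(\<lambda>n. perron x - 1 / Suc n) \<longlonglongrightarrow> perron x" by simp
  have ux_lim: "(\<lambda>n. u n x) \<longlonglongrightarrow> perron x"
  proof (rule tendsto_sandwich[OF _ _ low tendsto_const])
    show "\<forall>\<^sub>F n in sequentially. perron x - 1 / Suc n \<le> u n x"
      using ux less_imp_le by (intro always_eventually) blast
    show "\<forall>\<^sub>F n in sequentially. u n x \<le> perron x"
      using perron_upper[OF u] by (intro always_eventually) blast
  qed
  show "G (D\<phi> x) + V x + \<delta> * perron x \<le> 0"
  proof (rule subsolution_limit[where u = u and F = "\<lambda>n q x. G q + V x + \<delta> * u n x"
        and eps = "\<lambda>_. 0" and w = perron and x = x and \<phi> = \<phi> and D\<phi> = D\<phi>])
    show "continuous_on UNIV (u n)" "viscosity_subsolution (\<lambda>q x. G q + V x + \<delta> * u n x) 0 (u n)" for n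
      using u[of n] unfolding discounted_subsolutions_def by blast+
    show "u n y \<le> perron y + 0" for n y using perron_upper[OF u] by simp
    show "(\<lambda>n. G (q n) + V (y n) + \<delta> * u n (y n)) \<longlonglongrightarrow> G (D\<phi> x) + V x + \<delta> * perron x"
      if "q \<longlonglongrightarrow> D\<phi> x" "y \<longlonglongrightarrow> x" "(\<lambda>n. u n (y n)) \<longlonglongrightarrow> perron x" for q y
    proof (intro tendsto_add tendsto_mult_left that)
      show "(\<lambda>n. G (q n)) \<longlonglongrightarrow> G (D\<phi> x)"
        by (rule isCont_tendsto_compose[OF _ that(1)]) (use G_cont in \<open>simp add: continuous_on_eq_continuous_at\<close>)
      show "(\<lambda>n. V (y n)) \<longlonglongrightarrow> V x"
        by (rule isCont_tendsto_compose[OF _ that(2)]) (use V_cont in \<open>simp add: continuous_on_eq_continuous_at\<close>)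
    qed
  qed (use perron_continuous ux_lim * in auto)
qed

lemma perron_supersolution: "viscosity_supersolution (\<lambda>q x. G q + V x + \<delta> * perron x) 0 perron"
  unfolding viscosity_supersolution_def
proof (intro allI impI)
  fix \<phi> D\<phi> x0 assume *: "C1_with_gradient \<phi> D\<phi> \<and> local_min_at (\<lambda>y. perron y - \<phi> y) x0"
  show "0 \<le> G (D\<phi> x0) + V x0 + \<delta> * perron x0"
  proof (rule ccontr)
    define E where "E = - (G (D\<phi> x0) + V x0 + \<delta> * perron x0)"
    assume "\<not> ?thesis"
    then have E: "E > 0" by (simp add: E_def)
    \<comment> \<open>The test function bent down by a paraboloid and lifted by \<open>b\<close>.
      With \<open>b = r\<^sup>2\<close> lift and paraboloid cancel on the sphere of radius
      \<open>r\<close>, while at the centre \<open>perron\<close> is exceeded by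
      \<open>r\<^sup>2\<close>. The gradient does not depend on \<open>b\<close>.\<close>
    define \<theta> where "\<theta> = (\<lambda>b y. \<phi> y + - ((norm (y - x0))\<^sup>2) + (perron x0 - \<phi> x0 + b))"
    define D\<theta> where "D\<theta> = (\<lambda>y. D\<phi> y + - (2 *\<^sub>R (y - x0)) + 0)"
    have C1: "C1_with_gradient (\<theta> b) D\<theta>" for b
      unfolding \<theta>_def D\<theta>_def using *
      by (intro C1_add C1_minus C1_norm_square C1_const) simp
    define h where "h = (\<lambda>y. G (D\<theta> y) + V y + \<delta> * \<theta> 0 y)"
    have "continuous_on UNIV h"
      unfolding h_def using C1[of 0] C1_imp_continuous[OF C1[of 0]] V_cont
      by (intro continuous_on_add continuous_on_mult_left continuous_on_compose2[OF G_cont])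
        (auto simp: C1_with_gradient_def)
    then have "isCont h x0" by (simp add: continuous_on_eq_continuous_at)
    moreover have h0: "h x0 = - E" by (simp add: h_def D\<theta>_def \<theta>_def E_def)
    ultimately obtain d1 where d1: "d1 > 0" "\<And>y. dist y x0 < d1 \<Longrightarrow> dist (h y) (h x0) < E / 2"
      using E unfolding continuous_at_eps_delta by (metis half_gt_zero)
    obtain d2 where d2: "d2 > 0" "\<And>y. dist y x0 < d2 \<Longrightarrow> perron x0 - \<phi> x0 \<le> perron y - \<phi> y"
      using * unfolding local_min_at_def eventually_nhds_metric by blast
    \<comment> \<open>\<open>d1\<close> keeps the operator along \<open>\<theta> 0\<close> below
      \<open>- E / 2\<close>, and \<open>d2\<close> keeps the ball where \<open>\<phi>\<close>
      touches from below. The last two bounds give \<open>\<delta> * r\<^sup>2 \<le> E / 2\<close>,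
      so the lift uses up no more than the remaining margin.\<close>
    define r where "r = min (min (d1 / 2) (d2 / 2)) (min 1 (E / (2 * \<delta>)))"
    have r: "r > 0" "r < d1" "r < d2" "r \<le> 1" "r \<le> E / (2 * \<delta>)"
      using d1(1) d2(1) E \<delta> by (auto simp: r_def)
    have "\<delta> * r\<^sup>2 \<le> \<delta> * r" using r \<delta> by (simp add: power2_eq_square mult_left_le_one_le)
    also have "\<dots> \<le> E / 2" using r(5) \<delta> by (simp add: field_simps)
    finally have r_E: "\<delta> * r\<^sup>2 \<le> E / 2" .
    define u where "u = (\<lambda>y. if dist y x0 \<le> r then max (perron y) (\<theta> (r\<^sup>2) y) else perron y)"
    have strict: "G (D\<theta> y) + V y + \<delta> * \<theta> (r\<^sup>2) y \<le> 0" if "dist y x0 \<le> r" for y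
    proof -
      have "dist y x0 < d1" using that r(2) by linarith
      from d1(2)[OF this] have "h y < - E / 2" unfolding h0 dist_real_def by linarith
      moreover have "G (D\<theta> y) + V y + \<delta> * \<theta> (r\<^sup>2) y = h y + \<delta> * r\<^sup>2"
        by (simp add: h_def \<theta>_def algebra_simps)
      ultimately show ?thesis using r_E by linarith
    qed
    have boundary: "\<theta> (r\<^sup>2) y \<le> perron y" if "dist y x0 = r" for y
      using d2(2)[of y] that r(3) by (simp add: \<theta>_def dist_norm)
    have "u \<in> discounted_subsolutions"
      unfolding discounted_subsolutions_def
    proof (intro CollectI conjI allI)
      show "continuous_on UNIV u"
        unfolding u_def
        by (rule subsolution_bump[OF perron_continuous perron_subsolution C1 strict boundary])
      show "viscosity_subsolution (\<lambda>q x. G q + V x + \<delta> * u x) 0 u"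
        unfolding u_def
        by (rule subsolution_bump[OF perron_continuous perron_subsolution C1 strict boundary])
      show "- M \<le> \<delta> * u x" for x
      proof -
        have "\<delta> * perron x \<le> \<delta> * u x" using \<delta> by (intro mult_left_mono) (auto simp: u_def)
        then show ?thesis using perron_bounds[of x] by linarith
      qed
      have "continuous_on (cball x0 r) (\<theta> (r\<^sup>2))"
        using C1_imp_continuous[OF C1] continuous_on_subset by blast
      then obtain z where z: "\<And>y. y \<in> cball x0 r \<Longrightarrow> \<theta> (r\<^sup>2) y \<le> \<theta> (r\<^sup>2) z"
        using continuous_attains_sup[of "cball x0 r" "\<theta> (r\<^sup>2)"] r(1)
        by (metis cball_eq_empty compact_cball not_less_iff_gr_or_eq)
      have "u x \<le> max (M / \<delta>) (\<theta> (r\<^sup>2) z)" for x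
      proof -
        have "perron x \<le> M / \<delta>"
          using perron_bounds[of x] \<delta> by (simp add: pos_le_divide_eq mult.commute abs_le_iff)
        then show ?thesis using z[of x] by (auto simp: u_def dist_commute max_def)
      qed
      then show "\<exists>B. \<forall>x. u x \<le> B" by blast
    qed
    then have "u x0 \<le> perron x0" by (rule perron_upper)
    moreover have "perron x0 + r\<^sup>2 \<le> u x0" using r(1) by (simp add: u_def \<theta>_def)
    ultimately show False using zero_less_power[OF r(1), of 2] by linarith
  qed
qed

text \<open>Neither \<open>M\<close> nor the Lipschitz constant \<open>R + 1\<close> is tied to
  \<delta>; the passage to the limit \<delta> \<rightarrow> 0 rests on this uniformity.\<close>

lemma discounted_problem_solvable:
  "\<exists>w. Zn_periodic w \<and> (\<forall>x. \<bar>\<delta> * w x\<bar> \<le> M) \<and> (\<forall>x y. \<bar>w y - w x\<bar> \<le> (R + 1) * norm (y - x)) \<and>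
     viscosity_solution (\<lambda>q x. G q + V x + \<delta> * w x) 0 w"
  using perron_periodic perron_bounds perron_Lipschitz perron_subsolution perron_supersolution
  unfolding viscosity_solution_def by blast

end

section \<open>Vanishing discount\<close>

text \<open>The operator is kept as it is: a zeroth-order term inside \<open>F\<close> still refers
  to the unshifted function.\<close>

lemma viscosity_subsolution_shift:
  assumes "viscosity_subsolution F c u"
  shows "viscosity_subsolution F c (\<lambda>x. u x - k)"
proof -
  have "(a - k - b \<le> c - k - d) = (a - b \<le> c - d)" for a b c d :: real by linarith
  then show ?thesis
    using assms by (simp only: viscosity_subsolution_def local_max_at_def)
qed

lemma viscosity_supersolution_shift:
  assumes "viscosity_supersolution F c u"
  shows "viscosity_supersolution F c (\<lambda>x. u x - k)"
proof -
  have "(a - k - b \<le> c - k - d) = (a - b \<le> c - d)" for a b c d :: real by linarith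
  then show ?thesis
    using assms by (simp only: viscosity_supersolution_def local_min_at_def)
qed

text \<open>Arzela-Ascoli on the unit cube suffices, as periodicity carries uniform closeness to the
  whole space. For the selection, \<open>n \<le> t n\<close> already gives divergence, and the
  explicit rate later serves as the error term in the stability lemmas.\<close>

lemma equi_Lipschitz_periodic_subsequence:
  fixes v :: "nat \<Rightarrow> real ^ 'n \<Rightarrow> real"
  assumes lip: "\<And>n x y. \<bar>v n y - v n x\<bar> \<le> L * norm (y - x)" and L: "L \<ge> 0"
    and per: "\<And>n. Zn_periodic (v n)" and v0: "\<And>n. v n 0 = 0"
  obtains w t where "continuous_on UNIV w" "Zn_periodic w" "\<And>n. n \<le> t n"
    "\<And>n x. \<bar>v (t n) x - w x\<bar> < 1 / Suc n"
proof -
  obtain C where C: "\<And>x. x \<in> cbox (0 :: real ^ 'n) (vec 1) \<Longrightarrow> norm x \<le> C"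
    using bounded_cbox[of "0 :: real ^ 'n" "vec 1"] unfolding bounded_iff by blast
  have bound: "norm (v n x) \<le> L * C" if "x \<in> cbox 0 (vec 1)" for n x
  proof -
    have "\<bar>v n x\<bar> \<le> L * norm x" using lip[of n x 0] v0 by simp
    also have "\<dots> \<le> L * C" using C[OF that] L by (rule mult_left_mono)
    finally show ?thesis by simp
  qed
  have equi: "\<exists>d>0. \<forall>n y. y \<in> cbox 0 (vec 1) \<and> norm (x - y) < d \<longrightarrow> norm (v n x - v n y) < e"
    if "e > 0" for x e
  proof (intro exI[of _ "e / (L + 1)"] conjI allI impI)
    show "e / (L + 1) > 0" using that L by simp
    fix n y assume "y \<in> cbox 0 (vec 1) \<and> norm (x - y) < e / (L + 1)"
    then have "(L + 1) * norm (x - y) < e" using L by (simp add: pos_less_divide_eq mult.commute)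
    moreover have "L * norm (x - y) \<le> (L + 1) * norm (x - y)" by (simp add: algebra_simps)
    ultimately show "norm (v n x - v n y) < e" using lip[of n x y] by simp
  qed
  obtain g k where k: "strict_mono (k :: nat \<Rightarrow> nat)"
    and g: "\<And>e. 0 < e \<Longrightarrow> \<exists>N. \<forall>n x. n \<ge> N \<and> x \<in> cbox 0 (vec 1) \<longrightarrow> norm (v (k n) x - g x) < e"
    using Arzela_Ascoli[OF compact_cbox, of 0 "vec 1 :: real ^ 'n" v "L * C"] bound equi by metis
  define w where "w = (\<lambda>x. g (frac_vector x))"
  define P where "P = (\<lambda>n t. n \<le> t \<and> (\<forall>x. \<bar>v t x - w x\<bar> < 1 / Suc n))"
  have "\<exists>t. P n t" for n
  proof -
    have "1 / real (Suc n) > 0" by simp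
    from g[OF this] obtain N where
      N: "\<And>m x. m \<ge> N \<Longrightarrow> x \<in> cbox 0 (vec 1) \<Longrightarrow> norm (v (k m) x - g x) < 1 / Suc n"
      by blast
    define m where "m = max N n"
    have "n \<le> k m" using seq_suble[OF k, of m] by (simp add: m_def)
    moreover have "\<bar>v (k m) x - w x\<bar> < 1 / Suc n" for x
      using N[of m "frac_vector x"] frac_vector_in_unit_cube[of x] Zn_periodic_frac_vector[OF per, of "k m" x]
      by (simp add: w_def m_def)
    ultimately show ?thesis unfolding P_def by blast
  qed
  then obtain t where "\<And>n. P n (t n)" using choice[of P] by blast
  then have t: "n \<le> t n" and close: "\<bar>v (t n) x - w x\<bar> < 1 / Suc n" for n x
    unfolding P_def by blast+
  have zero: "(\<lambda>n. 1 / real (Suc n)) \<longlonglongrightarrow> 0"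
    using LIMSEQ_inverse_real_of_nat by (simp add: inverse_eq_divide)
  have lim: "(\<lambda>n. v (t n) x) \<longlonglongrightarrow> w x" for x
  proof (rule LIM_zero_cancel, rule Lim_null_comparison[OF _ zero])
    show "\<forall>\<^sub>F n in sequentially. norm (v (t n) x - w x) \<le> 1 / Suc n"
      using close less_imp_le by (intro always_eventually) (simp only: real_norm_def, blast)
  qed
  have "\<bar>w y - w x\<bar> \<le> L * norm (y - x)" for x y
    by (rule LIMSEQ_le_const2[OF tendsto_rabs[OF tendsto_diff[OF lim lim]]]) (use lip in blast)
  then have "continuous_on UNIV w" using L by (rule Lipschitz_imp_continuous_on)
  moreover have "Zn_periodic w"
    unfolding Zn_periodic_def
  proof (intro allI ballI)
    fix x m :: "real ^ 'n" assume "m \<in> integer_vectors"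
    then have "(\<lambda>n. v (t n) (x + m)) = (\<lambda>n. v (t n) x)"
      using per unfolding Zn_periodic_def by blast
    then show "w (x + m) = w x" using lim[of "x + m"] lim[of x] LIMSEQ_unique by metis
  qed
  ultimately show ?thesis using t close by (rule that)
qed

text \<open>Lions--Papanicolaou--Varadhan: the constant is the limit of \<open>- \<delta> w\<^sub>\<delta>(0)\<close> along a
  sequence of discount factors \<open>\<delta> \<rightarrow> 0\<close>.\<close>

lemma cell_problem_exists:
  fixes H V :: "real ^ 'n \<Rightarrow> real"
  assumes H_cont: "continuous_on UNIV H" and H_coercive: "coercive H"
    and V: "continuous_on UNIV V" "Zn_periodic V"
  shows "\<exists>c. cell_problem_solvable H V p c"
proof -
  define G where "G = (\<lambda>q. H (p + q))"
  have G_cont: "continuous_on UNIV G"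
    unfolding G_def by (intro continuous_on_compose2[OF H_cont] continuous_intros) auto
  obtain A where A: "A > 0" "\<And>x. \<bar>V x\<bar> \<le> A" using Zn_periodic_bounded V by blast
  have "compact (G ` cball 0 1)"
    using G_cont continuous_on_subset by (intro compact_continuous_image) auto
  then have "bounded (G ` cball 0 1)" by (rule compact_imp_bounded)
  then obtain M1 where "\<forall>y\<in>G ` cball 0 1. norm y \<le> M1" unfolding bounded_iff by blast
  then have M1: "\<And>q. norm q \<le> 1 \<Longrightarrow> \<bar>G q\<bar> \<le> M1" by simp
  define M where "M = M1 + A"
  have M: "\<bar>G q + V x\<bar> \<le> M" if "norm q \<le> 1" for q x
    using M1[OF that] A(2)[of x] unfolding M_def by linarith
  \<comment> \<open>The margin \<open>A\<close> absorbs the most negative value of \<open>V\<close>,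
    so that \<open>G q + V x\<close> still exceeds \<open>M\<close> for large
    \<open>q\<close>.\<close>
  have "\<forall>\<^sub>F z in at_infinity. M + A + 1 \<le> H z"
    using H_coercive unfolding coercive_def filterlim_at_top by blast
  then obtain b where b: "\<And>z. norm z \<ge> b \<Longrightarrow> M + A + 1 \<le> H z"
    by (auto simp: eventually_at_infinity)
  define R where "R = max 0 (b + norm p)"
  have R0: "R \<ge> 0" by (simp add: R_def)
  have R: "norm q \<le> R" if "G q + V x \<le> M" for q x
  proof (rule ccontr)
    assume "\<not> norm q \<le> R"
    then have "b \<le> norm q - norm p" by (simp add: R_def)
    also have "\<dots> \<le> norm (p + q)" using norm_triangle_ineq2[of q "- p"] by (simp add: add.commute)
    finally have "M + A + 1 \<le> G q" unfolding G_def by (rule b)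
    then show False using that A(2)[of x] by linarith
  qed
  define \<delta> where "\<delta> = (\<lambda>n. 1 / real (Suc n))"
  define P where "P = (\<lambda>n w. Zn_periodic w \<and> (\<forall>x. \<bar>\<delta> n * w x\<bar> \<le> M) \<and>
    (\<forall>x y. \<bar>w y - w x\<bar> \<le> (R + 1) * norm (y - x)) \<and>
     viscosity_solution (\<lambda>q x. G q + V x + \<delta> n * w x) 0 w)"
  have "\<exists>w. P n w" for n
    unfolding P_def by (rule discounted_problem_solvable[OF G_cont V _ R0 M R]) (simp_all add: \<delta>_def)
  then obtain w where "\<And>n. P n (w n)" using choice[of P] by blast
  then have w_per: "Zn_periodic (w n)" and w_bound: "\<bar>\<delta> n * w n x\<bar> \<le> M"
    and w_lip: "\<bar>w n y - w n x\<bar> \<le> (R + 1) * norm (y - x)"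
    and w_sol: "viscosity_solution (\<lambda>q x. G q + V x + \<delta> n * w n x) 0 (w n)" for n x y
    unfolding P_def by blast+
  have "bounded (range (\<lambda>n. \<delta> n * w n 0))"
    using w_bound by (intro boundedI[where B = M]) auto
  then obtain l r where r: "strict_mono (r :: nat \<Rightarrow> nat)" and l: "((\<lambda>n. \<delta> n * w n 0) \<circ> r) \<longlonglongrightarrow> l"
    using bounded_imp_convergent_subsequence by blast
  obtain v t where v: "continuous_on UNIV v" "Zn_periodic v" and t: "\<And>n. n \<le> t n"
    and close: "\<And>n x. \<bar>(w (r (t n)) x - w (r (t n)) 0) - v x\<bar> < 1 / Suc n"
  proof (rule equi_Lipschitz_periodic_subsequence[where v = "\<lambda>n x. w (r n) x - w (r n) 0" and L = "R + 1"])
    show "\<bar>w (r n) y - w (r n) 0 - (w (r n) x - w (r n) 0)\<bar> \<le> (R + 1) * norm (y - x)" for n x y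
      using w_lip[of "r n" y x] by simp
    show "Zn_periodic (\<lambda>x. w (r n) x - w (r n) 0)" for n
      using w_per unfolding Zn_periodic_def by simp
  qed (use R0 in auto)
  define s where "s = (\<lambda>n. r (t n))"
  \<comment> \<open>Only \<open>\<delta> * w\<close> is bounded uniformly and \<open>w\<close>
    itself may blow up; removing the value at 0 leaves functions controlled by the Lipschitz
    bound.\<close>
  define u where "u = (\<lambda>n x. w (s n) x - w (s n) 0)"
  have zero: "(\<lambda>n. 1 / real (Suc n)) \<longlonglongrightarrow> 0"
    using LIMSEQ_inverse_real_of_nat by (simp add: inverse_eq_divide)
  have t_lim: "filterlim t sequentially sequentially"
    by (rule filterlim_at_top_mono[OF filterlim_ident]) (use t in auto)
  have s_lim: "filterlim s sequentially sequentially"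
    unfolding s_def by (rule filterlim_compose[OF filterlim_subseq[OF r] t_lim])
  have \<delta>_lim: "(\<lambda>n. \<delta> (s n)) \<longlonglongrightarrow> 0"
    by (rule filterlim_compose[OF _ s_lim]) (use zero in \<open>simp add: \<delta>_def\<close>)
  have l_lim: "(\<lambda>n. \<delta> (s n) * w (s n) 0) \<longlonglongrightarrow> l"
    using filterlim_compose[OF l t_lim] by (simp add: s_def o_def)
  have u_lim: "(\<lambda>n. u n x) \<longlonglongrightarrow> v x" for x
  proof (rule LIM_zero_cancel, rule Lim_null_comparison[OF _ zero])
    show "\<forall>\<^sub>F n in sequentially. norm (u n x - v x) \<le> 1 / Suc n"
      using close less_imp_le unfolding u_def s_def
      by (intro always_eventually) (simp only: real_norm_def, blast)
  qed
  have u_cont: "continuous_on UNIV (u n)" for n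
  proof (rule Lipschitz_imp_continuous_on)
    show "\<bar>u n y - u n x\<bar> \<le> (R + 1) * norm (y - x)" for x y
      using w_lip[of "s n" y x] by (simp add: u_def)
  qed (use R0 in simp)
  \<comment> \<open>The discount term splits into \<open>\<delta> * u\<close>, which vanishes
    because \<open>u\<close> converges, and \<open>\<delta> * w\<close> at the origin, which tends
    to \<open>l\<close> and becomes the constant of the cell problem.\<close>
  have F_lim: "(\<lambda>n. G (q n) + V (y n) + \<delta> (s n) * w (s n) (y n)) \<longlonglongrightarrow> G Q + V x + (0 * v x + l)"
    if "q \<longlonglongrightarrow> Q" "y \<longlonglongrightarrow> x" "(\<lambda>n. u n (y n)) \<longlonglongrightarrow> v x" for q y Q x
  proof (intro tendsto_add)
    show "(\<lambda>n. G (q n)) \<longlonglongrightarrow> G Q"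
      by (rule isCont_tendsto_compose[OF _ that(1)]) (use G_cont in \<open>simp add: continuous_on_eq_continuous_at\<close>)
    show "(\<lambda>n. V (y n)) \<longlonglongrightarrow> V x"
      by (rule isCont_tendsto_compose[OF _ that(2)]) (use V in \<open>simp add: continuous_on_eq_continuous_at\<close>)
    have "(\<lambda>n. \<delta> (s n) * u n (y n) + \<delta> (s n) * w (s n) 0) \<longlonglongrightarrow> 0 * v x + l"
      by (rule tendsto_add[OF tendsto_mult[OF \<delta>_lim that(3)] l_lim])
    then show "(\<lambda>n. \<delta> (s n) * w (s n) (y n)) \<longlonglongrightarrow> 0 * v x + l"
      by (simp add: u_def algebra_simps)
  qed
  have sub: "viscosity_subsolution (\<lambda>q x. G q + V x + \<delta> (s n) * w (s n) x) 0 (u n)"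
    and super: "viscosity_supersolution (\<lambda>q x. G q + V x + \<delta> (s n) * w (s n) x) 0 (u n)" for n
    using w_sol[of "s n"] unfolding u_def viscosity_solution_def
    by (auto intro: viscosity_subsolution_shift viscosity_supersolution_shift)
  have "viscosity_solution (\<lambda>q x. H (p + q) + V x) (- l) v"
    unfolding viscosity_solution_def viscosity_subsolution_def viscosity_supersolution_def
  proof (intro conjI allI impI)
    fix \<phi> D\<phi> x assume *: "C1_with_gradient \<phi> D\<phi> \<and> local_max_at (\<lambda>y. v y - \<phi> y) x"
    have "G (D\<phi> x) + V x + (0 * v x + l) \<le> 0"
    proof (rule subsolution_limit[OF u_cont v(1) sub _ zero u_lim F_lim])
      show "u n y \<le> v y + 1 / Suc n" for n y
        using close[of n y] unfolding u_def s_def by linarith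
      show "C1_with_gradient \<phi> D\<phi>" "local_max_at (\<lambda>y. v y - \<phi> y) x" using * by auto
    qed
    then show "H (p + D\<phi> x) + V x \<le> - l" by (simp add: G_def)
  next
    fix \<phi> D\<phi> x assume *: "C1_with_gradient \<phi> D\<phi> \<and> local_min_at (\<lambda>y. v y - \<phi> y) x"
    have "0 \<le> G (D\<phi> x) + V x + (0 * v x + l)"
    proof (rule supersolution_limit[OF u_cont v(1) super _ zero u_lim F_lim])
      show "v y - 1 / Suc n \<le> u n y" for n y
        using close[of n y] unfolding u_def s_def by linarith
      show "C1_with_gradient \<phi> D\<phi>" "local_min_at (\<lambda>y. v y - \<phi> y) x" using * by auto
    qed
    then show "- l \<le> H (p + D\<phi> x) + V x" by (simp add: G_def)
  qed
  then show ?thesis using v unfolding cell_problem_solvable_def by blast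
qed

lemma cell_problem_unique:
  assumes "continuous_on UNIV V" "Zn_periodic V"
    and "cell_problem_solvable H V p c" "cell_problem_solvable H V p d"
  shows "c = d"
proof (rule antisym)
  obtain u v where u: "continuous_on UNIV u" "Zn_periodic u"
      "viscosity_solution (\<lambda>q x. H (p + q) + V x) c u"
    and v: "continuous_on UNIV v" "Zn_periodic v"
      "viscosity_solution (\<lambda>q x. H (p + q) + V x) d v"
    using assms(3,4) unfolding cell_problem_solvable_def by blast
  note sol = u(3)[unfolded viscosity_solution_def] v(3)[unfolded viscosity_solution_def]
  show "c \<le> d"
    using cell_problem_comparison[OF v(1,2) u(1,2) assms(1,2), of "\<lambda>q. H (p + q)" d c] sol by blast
  show "d \<le> c"
    using cell_problem_comparison[OF u(1,2) v(1,2) assms(1,2), of "\<lambda>q. H (p + q)" c d] sol by blast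
qed

lemma cell_problem_solvable_effective_hamiltonian:
  assumes "continuous_on UNIV H" "coercive H" "continuous_on UNIV V" "Zn_periodic V"
  shows "cell_problem_solvable H V p (effective_hamiltonian H V p)"
  unfolding effective_hamiltonian_def
  by (rule theI') (use cell_problem_exists[OF assms, of p] cell_problem_unique[OF assms(3,4)] in blast)

section \<open>The cohomological equation for trigonometric polynomials\<close>

text \<open>Up to normalization this is the de la Vallee Poussin kernel. The even power makes it
  nonnegative and 1-periodic, with integer frequencies \<open>k - N\<close>; its mean is the central
  term \<open>k = N\<close>.\<close>

lemma cos_even_power_expansion:
  "complex_of_real (cos (pi * t) ^ (2 * N)) =
     (\<Sum>k\<le>2 * N. of_real (((2 * N) choose k) / 4 ^ N) * cis (2 * pi * ((real k - real N) * t)))"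
proof -
  have "complex_of_real (cos (pi * t)) = (cis (pi * t) + cis (- (pi * t))) / 2"
    by (simp add: complex_eq_iff)
  then have "complex_of_real (cos (pi * t) ^ (2 * N)) = ((cis (pi * t) + cis (- (pi * t))) / 2) ^ (2 * N)"
    by (simp only: of_real_power)
  also have "\<dots> = (cis (pi * t) + cis (- (pi * t))) ^ (2 * N) / 4 ^ N"
    by (simp only: power_divide) (simp add: power_mult)
  also have "\<dots> = (\<Sum>k\<le>2 * N. of_nat ((2 * N) choose k) * cis (pi * t) ^ k * cis (- (pi * t)) ^ (2 * N - k)) / 4 ^ N"
    by (simp only: binomial_ring)
  also have "\<dots> = (\<Sum>k\<le>2 * N. of_real (((2 * N) choose k) / 4 ^ N) * cis (2 * pi * ((real k - real N) * t)))"
    unfolding sum_divide_distrib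
  proof (rule sum.cong[OF refl])
    fix k assume "k \<in> {..2 * N}"
    then have "real k * (pi * t) + real (2 * N - k) * (- (pi * t)) = 2 * pi * ((real k - real N) * t)"
      by (simp add: of_nat_diff algebra_simps)
    then have "cis (pi * t) ^ k * cis (- (pi * t)) ^ (2 * N - k) = cis (2 * pi * ((real k - real N) * t))"
      by (simp only: Complex.DeMoivre cis_mult)
    then show "of_nat ((2 * N) choose k) * cis (pi * t) ^ k * cis (- (pi * t)) ^ (2 * N - k) / 4 ^ N =
        of_real (((2 * N) choose k) / 4 ^ N) * cis (2 * pi * ((real k - real N) * t))"
      by (simp add: mult.assoc)
  qed
  finally show ?thesis .
qed

lemma cis_sum: "finite A \<Longrightarrow> (\<Prod>i\<in>A. cis (f i)) = cis (\<Sum>i\<in>A. f i)"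
  by (induction A rule: finite_induct) (simp_all add: cis_mult)

text \<open>The detour through complex exponentials makes the product multiplicative: coordinate
  frequencies assemble into lattice vectors, and the real part is taken at the end.\<close>

lemma cos_even_power_product_expansion:
  fixes x :: "real ^ 'n"
  shows "(\<Prod>i\<in>UNIV. cos (pi * x $ i) ^ (2 * N)) =
    (\<Sum>g\<in>PiE UNIV (\<lambda>_. {..2 * N}). (\<Prod>i\<in>UNIV. ((2 * N) choose g i) / 4 ^ N) *
       cos (2 * pi * ((\<chi> i. real (g i) - real N) \<bullet> x)))"
proof -
  have "complex_of_real (\<Prod>i\<in>UNIV. cos (pi * x $ i) ^ (2 * N)) =
     (\<Prod>i\<in>UNIV. \<Sum>k\<le>2 * N. of_real (((2 * N) choose k) / 4 ^ N) * cis (2 * pi * ((real k - real N) * x $ i)))"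
    by (simp only: of_real_prod cos_even_power_expansion)
  also have "\<dots> = (\<Sum>g\<in>PiE UNIV (\<lambda>_. {..2 * N}). \<Prod>i\<in>UNIV.
      of_real (((2 * N) choose g i) / 4 ^ N) * cis (2 * pi * ((real (g i) - real N) * x $ i)))"
    by (rule prod_sum_PiE) auto
  also have "\<dots> = (\<Sum>g\<in>PiE UNIV (\<lambda>_. {..2 * N}). of_real (\<Prod>i\<in>UNIV. ((2 * N) choose g i) / 4 ^ N) *
       cis (2 * pi * ((\<chi> i. real (g i) - real N) \<bullet> x)))"
  proof (rule sum.cong[OF refl])
    fix g :: "'n \<Rightarrow> nat"
    have "(\<Prod>i\<in>UNIV. cis (2 * pi * ((real (g i) - real N) * x $ i))) =
        cis (2 * pi * ((\<chi> i. real (g i) - real N) \<bullet> x))"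
      by (simp add: cis_sum inner_vec_def sum_distrib_left)
    then show "(\<Prod>i\<in>UNIV. of_real (((2 * N) choose g i) / 4 ^ N) * cis (2 * pi * ((real (g i) - real N) * x $ i)))
       = of_real (\<Prod>i\<in>UNIV. ((2 * N) choose g i) / 4 ^ N) * cis (2 * pi * ((\<chi> i. real (g i) - real N) \<bullet> x))"
      by (simp only: prod.distrib of_real_prod)
  qed
  finally have "Re (complex_of_real (\<Prod>i\<in>UNIV. cos (pi * x $ i) ^ (2 * N))) = Re \<dots>"
    by (rule arg_cong)
  moreover have "Re (of_real c * z) = c * Re z" for c z by simp
  ultimately show ?thesis by (simp only: Re_complex_of_real Re_sum cis.sel)
qed

lemma integer_vectors_inner:
  assumes "m \<in> integer_vectors" "k \<in> integer_vectors"
  shows "m \<bullet> k \<in> \<int>"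
  using assms unfolding inner_vec_def integer_vectors_def by (auto intro!: Ints_sum Ints_mult)

text \<open>The small divisors \<open>q \<bullet> m\<close> do not vanish, so \<open>q \<bullet> D\<psi> = W\<close> can be solved for every
  trigonometric polynomial \<open>W\<close> of mean zero.\<close>

lemma linear_cohomological_equation:
  fixes m :: "'i \<Rightarrow> real ^ 'n"
  assumes fin: "finite I" and int: "\<And>i. i \<in> I \<Longrightarrow> m i \<in> integer_vectors"
    and nonres: "\<And>i. i \<in> I \<Longrightarrow> q \<bullet> m i \<noteq> 0"
  obtains \<psi> D\<psi> B where "C1_with_gradient \<psi> D\<psi>" "Zn_periodic \<psi>" "B \<ge> 0" "\<And>x. norm (D\<psi> x) \<le> B"
    "\<And>x. q \<bullet> D\<psi> x = (\<Sum>i\<in>I. b i * cos (2 * pi * (m i \<bullet> (x - z))))"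
proof
  \<comment> \<open>An antiderivative in direction \<open>q\<close>, term by term: differentiating
    the sine produces the factor \<open>2 * pi * (q \<bullet> m i)\<close>, which the coefficient
    cancels.\<close>
  define \<psi> where "\<psi> = (\<lambda>x. \<Sum>i\<in>I. (b i / (2 * pi * (q \<bullet> m i))) * sin (2 * pi * (m i \<bullet> (x - z))))"
  define D\<psi> where "D\<psi> = (\<lambda>x. \<Sum>i\<in>I. (b i / (2 * pi * (q \<bullet> m i))) *\<^sub>R
      (cos (2 * pi * (m i \<bullet> (x - z))) *\<^sub>R ((2 * pi) *\<^sub>R m i)))"
  define B where "B = (\<Sum>i\<in>I. \<bar>b i / (2 * pi * (q \<bullet> m i))\<bar> * norm ((2 * pi) *\<^sub>R m i))"
  have sin_C1: "C1_with_gradient (\<lambda>x. sin (2 * pi * (k \<bullet> (x - z))))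
      (\<lambda>x. cos (2 * pi * (k \<bullet> (x - z))) *\<^sub>R ((2 * pi) *\<^sub>R k))" for k
    unfolding C1_with_gradient_def
  proof (intro conjI allI)
    fix x
    have "((\<lambda>x. 2 * pi * (k \<bullet> (x - z))) has_derivative (\<lambda>h. 2 * pi * (k \<bullet> (h - 0)))) (at x)"
      by (intro has_derivative_mult_right has_derivative_inner_right has_derivative_diff
          has_derivative_ident has_derivative_const)
    then have "GDERIV (\<lambda>x. 2 * pi * (k \<bullet> (x - z))) x :> (2 * pi) *\<^sub>R k"
      by (simp add: gderiv_def inner_commute)
    then show "GDERIV (\<lambda>x. sin (2 * pi * (k \<bullet> (x - z)))) x :>
        cos (2 * pi * (k \<bullet> (x - z))) *\<^sub>R ((2 * pi) *\<^sub>R k)"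
      by (rule GDERIV_DERIV_compose[where g = sin]) (rule DERIV_sin)
    show "continuous_on UNIV (\<lambda>x. cos (2 * pi * (k \<bullet> (x - z))) *\<^sub>R ((2 * pi) *\<^sub>R k))"
      by (intro continuous_intros)
  qed
  show "C1_with_gradient \<psi> D\<psi>"
    unfolding \<psi>_def D\<psi>_def by (rule C1_sum[OF C1_scale[OF sin_C1]])
  show "Zn_periodic \<psi>"
    unfolding Zn_periodic_def \<psi>_def
  proof (intro allI ballI sum.cong[OF refl] arg_cong[where f = "\<lambda>t. _ * t"])
    fix x k :: "real ^ 'n" and i assume "k \<in> integer_vectors" "i \<in> I"
    then obtain j where j: "m i \<bullet> k = of_int j"
      using integer_vectors_inner[OF int] by (metis Ints_cases)
    have "2 * pi * (m i \<bullet> (x + k - z)) = 2 * pi * (m i \<bullet> (x - z)) + (2 * pi) * of_int j"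
      by (simp add: j[symmetric] inner_add_right inner_diff_right algebra_simps)
    then show "sin (2 * pi * (m i \<bullet> (x + k - z))) = sin (2 * pi * (m i \<bullet> (x - z)))"
      by (simp add: sin_add)
  qed
  show "B \<ge> 0" unfolding B_def by (intro sum_nonneg mult_nonneg_nonneg) auto
  show "norm (D\<psi> x) \<le> B" for x
    unfolding D\<psi>_def B_def
  proof (rule sum_norm_le)
    fix i
    have "norm (cos (2 * pi * (m i \<bullet> (x - z))) *\<^sub>R ((2 * pi) *\<^sub>R m i)) \<le> 1 * norm ((2 * pi) *\<^sub>R m i)"
      unfolding norm_scaleR[of "cos _"] by (intro mult_right_mono) auto
    then show "norm ((b i / (2 * pi * (q \<bullet> m i))) *\<^sub>R (cos (2 * pi * (m i \<bullet> (x - z))) *\<^sub>R ((2 * pi) *\<^sub>R m i)))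
      \<le> \<bar>b i / (2 * pi * (q \<bullet> m i))\<bar> * norm ((2 * pi) *\<^sub>R m i)"
      unfolding norm_scaleR[of "b i / _"] by (intro mult_left_mono) auto
  qed
  show "q \<bullet> D\<psi> x = (\<Sum>i\<in>I. b i * cos (2 * pi * (m i \<bullet> (x - z))))" for x
    unfolding D\<psi>_def inner_sum_right
  proof (rule sum.cong[OF refl])
    fix i assume "i \<in> I"
    then show "q \<bullet> ((b i / (2 * pi * (q \<bullet> m i))) *\<^sub>R (cos (2 * pi * (m i \<bullet> (x - z))) *\<^sub>R ((2 * pi) *\<^sub>R m i)))
        = b i * cos (2 * pi * (m i \<bullet> (x - z)))"
      using nonres[of i] by simp
  qed
qed

lemma abs_cos_add_int: "\<bar>cos (pi * (t + of_int k))\<bar> = \<bar>cos (pi * t)\<bar>"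
  by (simp add: distrib_left cos_add)

text \<open>The central coefficient is at least \<open>1 / (2 * N)\<close>, so the right side decays
  polynomially and the left geometrically. Taking the root of order \<open>Suc d\<close> reduces the
  comparison to \<open>n * \<tau> ^ n\<close> tending to 0.\<close>

lemma power_less_central_coefficient:
  assumes "0 \<le> \<rho>" "\<rho> < 1"
  obtains N where "\<rho> ^ (2 * N) < (((2 * N) choose N) / 4 ^ N) ^ Suc d"
proof -
  define \<tau> where "\<tau> = root (Suc d) (\<rho>\<^sup>2)"
  have \<rho>2: "\<rho>\<^sup>2 < 1" using assms by (simp add: power_less_one_iff abs_square_less_1)
  have \<tau>: "0 \<le> \<tau>" "\<tau> < 1" "\<tau> ^ Suc d = \<rho>\<^sup>2"
    using \<rho>2 real_root_less_iff[of "Suc d" "\<rho>\<^sup>2" 1] by (simp_all add: \<tau>_def del: power_Suc)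
  have "(\<lambda>n. real n * \<tau> ^ n) \<longlonglongrightarrow> 0" using powser_times_n_limit_0[of \<tau>] \<tau> by simp
  then have "\<forall>\<^sub>F n in sequentially. real n * \<tau> ^ n < 1 / 2" by (rule order_tendstoD) simp
  then obtain N0 where N0: "\<And>n. n \<ge> N0 \<Longrightarrow> real n * \<tau> ^ n < 1 / 2"
    unfolding eventually_sequentially by blast
  define N where "N = Suc N0"
  have N: "N > 0" "real N * \<tau> ^ N < 1 / 2" unfolding N_def using N0[of "Suc N0"] by (simp_all del: power_Suc of_nat_Suc)
  have "\<tau> ^ N < 1 / (2 * real N)" using N by (simp add: field_simps)
  also have "\<dots> \<le> ((2 * N) choose N) / 4 ^ N"
    using central_binomial_lower_bound[OF N(1)] by (simp add: field_simps)
  finally have "(\<tau> ^ N) ^ Suc d < (((2 * N) choose N) / 4 ^ N) ^ Suc d"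
    using \<tau>(1) by (intro power_strict_mono) auto
  also have "(\<tau> ^ N) ^ Suc d = (\<tau> ^ Suc d) ^ N" by (simp only: power_mult[symmetric] mult.commute)
  also have "\<dots> = \<rho> ^ (2 * N)" by (simp only: \<tau>(3) power_mult)
  finally show ?thesis by (rule that)
qed

text \<open>With \<open>V \<le> 0\<close> and \<open>V < - a\<close> near \<open>x0\<close>, the kernel \<open>K(x) = \<Prod>\<^sub>i cos\<^sup>2\<^sup>N (\<pi> (x - x0)\<^sub>i)\<close> satisfies
  \<open>V \<le> - a K + a \<rho>\<^sup>2\<^sup>N\<close>: away from \<open>x0\<close> modulo integers it is at most \<open>\<rho>\<^sup>2\<^sup>N\<close>. Its mean
  decays only polynomially in \<open>N\<close>, so the majorant has negative mean for large \<open>N\<close>.\<close>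

lemma strict_corrector:
  fixes V :: "real ^ 'n \<Rightarrow> real"
  assumes V_cont: "continuous_on UNIV V" and V_per: "Zn_periodic V" and V_nonpos: "\<And>x. V x \<le> 0"
    and V_neg: "V x0 < 0" and q: "irrational_vector q"
  obtains \<psi> D\<psi> B \<eta> where "C1_with_gradient \<psi> D\<psi>" "Zn_periodic \<psi>" "B \<ge> 0" "\<And>x. norm (D\<psi> x) \<le> B"
    "\<eta> > 0" "\<And>x. V x + q \<bullet> D\<psi> x \<le> - \<eta>"
proof -
  define a where "a = - V x0 / 2"
  have a: "a > 0" using V_neg by (simp add: a_def)
  have "isCont V x0" using V_cont by (simp add: continuous_on_eq_continuous_at)
  then obtain d where d: "d > 0" "\<And>y. dist y x0 < d \<Longrightarrow> dist (V y) (V x0) < a"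
    using a unfolding continuous_at_eps_delta by blast
  have near: "V y < - a" if "dist y x0 < d" for y
    using d(2)[OF that] unfolding dist_real_def a_def by linarith
  \<comment> \<open>\<open>1 / 2\<close> keeps \<open>pi * r\<close> where cosine is nonnegative and
    decreasing; the division by the dimension is due to bounding the norm by the sum of the
    coordinates.\<close>
  define r where "r = min (1 / 2) (d / CARD('n))"
  have r: "0 < r" "r \<le> 1 / 2" "CARD('n) * r \<le> d"
    using d(1) by (auto simp: r_def field_simps min_def)
  define \<rho> where "\<rho> = cos (pi * r)"
  have pr: "0 < pi * r" "pi * r \<le> pi / 2" using r by simp_all
  have \<rho>0: "0 \<le> \<rho>" unfolding \<rho>_def by (rule cos_ge_zero) (use pr in linarith)+
  have "cos (pi * r) < cos 0" by (rule cos_monotone_0_pi) (use pr in linarith)+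
  then have \<rho>1: "\<rho> < 1" by (simp add: \<rho>_def)
  obtain N where N: "\<rho> ^ (2 * N) < (((2 * N) choose N) / 4 ^ N) ^ Suc (CARD('n) - 1)"
    using power_less_central_coefficient[OF \<rho>0 \<rho>1] by blast
  \<comment> \<open>The mean of the kernel: the coefficient of the zero frequency, which belongs to
    the constant index function \<open>N\<close> and is left out of \<open>I\<close> below.\<close>
  define c0 where "c0 = (((2 * N) choose N) / 4 ^ N :: real) ^ CARD('n)"
  have c0: "\<rho> ^ (2 * N) < c0" using N zero_less_card_finite[where 'a = 'n] by (simp add: c0_def del: power_Suc)
  define K where "K = (\<lambda>x :: real ^ 'n. \<Prod>i\<in>UNIV. cos (pi * (x - x0) $ i) ^ (2 * N))"
  define I where "I = PiE (UNIV :: 'n set) (\<lambda>_. {..2 * N}) - {\<lambda>_. N}"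
  define coef where "coef = (\<lambda>g. \<Prod>i\<in>(UNIV :: 'n set). ((2 * N) choose g i) / 4 ^ N :: real)"
  define m where "m = (\<lambda>g. (\<chi> i. real (g i) - real N) :: real ^ 'n)"
  have K_expand: "K x = c0 + (\<Sum>g\<in>I. coef g * cos (2 * pi * (m g \<bullet> (x - x0))))" for x
  proof -
    have fin: "finite (PiE (UNIV :: 'n set) (\<lambda>_. {..2 * N}))" by (intro finite_PiE) auto
    have mem: "(\<lambda>_. N) \<in> PiE (UNIV :: 'n set) (\<lambda>_. {..2 * N})" by (auto simp: PiE_def)
    have "m (\<lambda>_. N) = 0" by (simp add: m_def vec_eq_iff)
    then have "c0 = coef (\<lambda>_. N) * cos (2 * pi * (m (\<lambda>_. N) \<bullet> (x - x0)))"
      by (simp add: c0_def coef_def)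
    moreover have "K x = (\<Sum>g\<in>PiE UNIV (\<lambda>_. {..2 * N}). coef g * cos (2 * pi * (m g \<bullet> (x - x0))))"
      unfolding K_def coef_def m_def by (rule cos_even_power_product_expansion)
    ultimately show ?thesis unfolding I_def by (simp add: sum.remove[OF fin mem])
  qed
  have fin: "finite I" unfolding I_def by (intro finite_Diff finite_PiE) auto
  have int: "m g \<in> integer_vectors" for g by (simp add: m_def integer_vectors_def)
  have nonres: "q \<bullet> m g \<noteq> 0" if "g \<in> I" for g
  proof -
    have "\<exists>i. g i \<noteq> N" using that by (auto simp: I_def)
    then have "m g \<noteq> 0" by (auto simp: m_def vec_eq_iff)
    then show ?thesis using q int unfolding irrational_vector_def by blast
  qed
  obtain \<psi> D\<psi> B where \<psi>: "C1_with_gradient \<psi> D\<psi>" "Zn_periodic \<psi>" "B \<ge> 0" "\<And>x. norm (D\<psi> x) \<le> B"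
    and eq: "\<And>x. q \<bullet> D\<psi> x = (\<Sum>g\<in>I. (a * coef g) * cos (2 * pi * (m g \<bullet> (x - x0))))"
    using linear_cohomological_equation[where I = I and m = m and q = q
        and b = "\<lambda>g. a * coef g" and z = x0, OF fin int nonres] by blast
  \<comment> \<open>When this is added to the majorant of \<open>V\<close> below, \<open>K\<close>
    cancels and only the constant \<open>- a * (c0 - \<rho> ^ (2 * N))\<close> remains.\<close>
  have eq': "q \<bullet> D\<psi> x = a * (K x - c0)" for x
    unfolding eq K_expand by (simp add: sum_distrib_left mult.assoc)
  have V_le: "V x \<le> - (a * K x) + a * \<rho> ^ (2 * N)" for x
  proof (cases "\<exists>i. \<bar>cos (pi * (x - x0) $ i)\<bar> \<le> \<rho>")
    case True
    then obtain i where i: "\<bar>cos (pi * (x - x0) $ i)\<bar> \<le> \<rho>" by blast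
    have "K x = cos (pi * (x - x0) $ i) ^ (2 * N) * (\<Prod>i\<in>UNIV - {i}. cos (pi * (x - x0) $ i) ^ (2 * N))"
      unfolding K_def by (rule prod.remove) auto
    also have "\<dots> \<le> \<rho> ^ (2 * N) * 1"
    proof (rule mult_mono)
      have "\<bar>cos (pi * (x - x0) $ i)\<bar> ^ (2 * N) \<le> \<rho> ^ (2 * N)" using i by (rule power_mono) simp
      then show "cos (pi * (x - x0) $ i) ^ (2 * N) \<le> \<rho> ^ (2 * N)" by (simp add: power_even_abs)
      show "(\<Prod>i\<in>UNIV - {i}. cos (pi * (x - x0) $ i) ^ (2 * N)) \<le> 1"
        by (rule prod_le_1) (auto simp: power_mult power_le_one abs_square_le_1)
    qed (use \<rho>0 in \<open>auto intro: prod_nonneg simp: power_mult\<close>)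
    finally have "a * K x \<le> a * \<rho> ^ (2 * N)" using a by simp
    then show ?thesis using V_nonpos[of x] by linarith
  next
    case False
    \<comment> \<open>The nearest lattice vector leaves coordinates of modulus at most
      \<open>1 / 2\<close>. There the cosine is even and decreases with the modulus, so cosines
      above \<open>\<rho>\<close> force every coordinate below \<open>r\<close>.\<close>
    define k :: "real ^ 'n" where "k = (\<chi> i. of_int (round ((x - x0) $ i)))"
    have k: "k \<in> integer_vectors" by (simp add: k_def integer_vectors_def)
    have small: "\<bar>(x - k - x0) $ i\<bar> < r" for i
    proof (rule ccontr)
      define s where "s = (x - k - x0) $ i"
      assume "\<not> \<bar>(x - k - x0) $ i\<bar> < r"
      then have s: "r \<le> \<bar>s\<bar>" by (simp add: s_def)
      have s_half: "\<bar>s\<bar> \<le> 1 / 2"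
        using of_int_round_abs_le[of "(x - x0) $ i"] unfolding s_def k_def by (simp add: abs_minus_commute algebra_simps)
      have "cos (pi * \<bar>s\<bar>) \<le> cos (pi * r)"
        using r s s_half by (intro cos_monotone_0_pi_le) auto
      moreover have "cos (pi * \<bar>s\<bar>) = cos (pi * s)"
        by (cases "s \<ge> 0") (auto simp: abs_if)
      moreover have "0 \<le> cos (pi * s)"
      proof -
        have "\<bar>pi * s\<bar> \<le> pi / 2" using s_half by (simp add: abs_mult)
        then show ?thesis by (intro cos_ge_zero) linarith+
      qed
      ultimately have "\<bar>cos (pi * s)\<bar> \<le> \<rho>" by (simp add: \<rho>_def)
      moreover have "(x - x0) $ i = s + of_int (round ((x - x0) $ i))"
        by (simp add: s_def k_def)
      ultimately have "\<bar>cos (pi * (x - x0) $ i)\<bar> \<le> \<rho>" using abs_cos_add_int by metis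
      then show False using False by blast
    qed
    have "norm (x - k - x0) \<le> (\<Sum>i\<in>UNIV. \<bar>(x - k - x0) $ i\<bar>)" by (rule norm_le_l1_cart)
    also have "\<dots> < of_nat (CARD('n)) * r"
      by (rule sum_bounded_above_strict) (use small in auto)
    also have "\<dots> \<le> d" by (rule r)
    finally have "V (x - k) < - a" by (intro near) (simp add: dist_norm)
    then have "V x < - a" using Zn_periodic_minus[OF V_per k] by simp
    moreover have "K x \<le> 1"
      unfolding K_def by (rule prod_le_1) (auto simp: power_mult power_le_one abs_square_le_1)
    then have "a * K x \<le> a" using a by simp
    moreover have "0 \<le> a * \<rho> ^ (2 * N)" using a \<rho>0 by simp
    ultimately show ?thesis by linarith
  qed
  have "a * (c0 - \<rho> ^ (2 * N)) > 0" using a c0 by simp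
  moreover have "V x + q \<bullet> D\<psi> x \<le> - (a * (c0 - \<rho> ^ (2 * N)))" for x
    using V_le[of x] eq'[of x] by (simp add: algebra_simps)
  ultimately show ?thesis using that \<psi> by blast
qed

section \<open>Effective Hamiltonians\<close>

lemma potential_vanishes:
  fixes H V :: "real ^ 'n \<Rightarrow> real"
  assumes V_cont: "continuous_on UNIV V" and V_per: "Zn_periodic V" and V_nonpos: "\<And>x. V x \<le> 0"
    and deriv: "GDERIV H p :> q" and irr: "irrational_vector q"
    and solv: "cell_problem_solvable H V p (H p)"
  shows "V x = 0"
proof (rule ccontr)
  assume "V x \<noteq> 0"
  then have "V x < 0" using V_nonpos[of x] by simp
  then obtain \<psi> D\<psi> B \<eta> where C1: "C1_with_gradient \<psi> D\<psi>" and per: "Zn_periodic \<psi>" and B: "B \<ge> 0"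
    and D_le: "\<And>x. norm (D\<psi> x) \<le> B" and \<eta>: "\<eta> > 0" and corr: "\<And>x. V x + q \<bullet> D\<psi> x \<le> - \<eta>"
    using strict_corrector[OF V_cont V_per V_nonpos _ irr] by blast
  obtain v where v: "continuous_on UNIV v" "Zn_periodic v"
    and super: "viscosity_supersolution (\<lambda>q x. H (p + q) + V x) (H p) v"
    using solv unfolding cell_problem_solvable_def viscosity_solution_def by blast
  \<comment> \<open>The linearization error is at most \<open>e * (k * B)\<close>; this choice
    limits it to half of the gain \<open>k * \<eta>\<close>. Using \<open>B + 1\<close> covers the
    case \<open>B = 0\<close>.\<close>
  define e where "e = \<eta> / (2 * (B + 1))"
  have e: "e > 0" using \<eta> B by (simp add: e_def)
  have eB: "e * B \<le> \<eta> / 2"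
  proof -
    have "e * B \<le> e * (B + 1)" using e by simp
    also have "\<dots> = \<eta> / 2" using B by (simp add: e_def field_simps)
    finally show ?thesis .
  qed
  obtain d where d: "d > 0"
    "\<And>y. norm (y - p) < d \<Longrightarrow> norm (H y - H p - (y - p) \<bullet> q) \<le> e * norm (y - p)"
    using deriv e unfolding gderiv_def has_derivative_at_alt by blast
  \<comment> \<open>The bound 1 is for \<open>V \<le> k * V\<close>; the other keeps
    \<open>p + k *\<^sub>R D\<psi> y\<close> where the first-order expansion of \<open>H\<close> at
    \<open>p\<close> is controlled by \<open>e\<close>.\<close>
  define k where "k = min 1 (d / (2 * (B + 1)))"
  have k: "k > 0" "k \<le> 1" using d(1) B by (auto simp: k_def)
  have kB: "k * B < d"
  proof -
    have "k * B \<le> (d / (2 * (B + 1))) * (B + 1)" using B d(1) k by (intro mult_mono) (auto simp: k_def)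
    also have "\<dots> = d / 2" using B by (simp add: field_simps)
    finally show ?thesis using d(1) by simp
  qed
  have "continuous_on UNIV (\<lambda>y. v y - k * \<psi> y)"
    by (intro continuous_on_diff v continuous_on_mult_left C1_imp_continuous[OF C1])
  moreover have "Zn_periodic (\<lambda>y. v y - k * \<psi> y)"
    using v(2) per by (simp add: Zn_periodic_def)
  ultimately obtain y where "\<And>z. v y - k * \<psi> y \<le> v z - k * \<psi> z"
    using Zn_periodic_attains_inf[of "\<lambda>y. v y - k * \<psi> y"] by blast
  then have "H p \<le> H (p + k *\<^sub>R D\<psi> y) + V y"
    by (intro viscosity_supersolutionD[OF super C1_scale[OF C1]] local_min_at_global)
  moreover have "H (p + k *\<^sub>R D\<psi> y) - H p - k * (q \<bullet> D\<psi> y) \<le> k * (\<eta> / 2)"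
  proof -
    have n: "norm (k *\<^sub>R D\<psi> y) \<le> k * B" using D_le[of y] k by (simp add: mult_left_mono)
    then have "norm (H (p + k *\<^sub>R D\<psi> y) - H p - (k *\<^sub>R D\<psi> y) \<bullet> q) \<le> e * norm (k *\<^sub>R D\<psi> y)"
      using d(2)[of "p + k *\<^sub>R D\<psi> y"] kB by simp
    also have "\<dots> \<le> e * (k * B)" using n e by simp
    also have "\<dots> \<le> k * (\<eta> / 2)" using mult_left_mono[OF eB, of k] k by (simp add: mult.left_commute)
    finally have "norm (H (p + k *\<^sub>R D\<psi> y) - H p - (k *\<^sub>R D\<psi> y) \<bullet> q) \<le> k * (\<eta> / 2)" .
    moreover have "(k *\<^sub>R D\<psi> y) \<bullet> q = k * (q \<bullet> D\<psi> y)" by (simp add: inner_commute)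
    ultimately show ?thesis unfolding real_norm_def by linarith
  qed
  moreover have "V y \<le> k * V y"
    using mult_right_mono_neg[OF k(2) V_nonpos[of y]] by simp
  moreover have "k * V y + k * (q \<bullet> D\<psi> y) \<le> - (k * \<eta>)"
    using mult_left_mono[OF corr[of y], of k] k by (simp add: distrib_left)
  moreover have "k * (\<eta> / 2) < k * \<eta>" using k \<eta> by simp
  ultimately show False by linarith
qed

text \<open>The inequality holds at every point where some test function touches \<open>v\<close>
  from above. A steep rounded cone with vertex \<open>x\<close> produces such points arbitrarily
  close to \<open>x\<close>, and continuity of \<open>V\<close> does the rest.\<close>

lemma subsolution_lower_bound:
  fixes v V :: "real ^ 'n \<Rightarrow> real"
  assumes v: "continuous_on UNIV v" "Zn_periodic v" and V: "continuous_on UNIV V" "Zn_periodic V"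
    and sub: "viscosity_subsolution (\<lambda>q x. G q + V x) c v" and G: "\<And>q. h \<le> G q"
  shows "h + V x \<le> c"
proof (rule field_le_epsilon)
  fix e :: real assume "e > 0"
  obtain A where A: "A > 0" "\<And>x. \<bar>v x\<bar> \<le> A" using Zn_periodic_bounded v by blast
  obtain d where d: "d > 0" "\<And>x y. dist x y < d \<Longrightarrow> dist (V x) (V y) < e"
    using Zn_periodic_uniformly_continuous[OF V \<open>e > 0\<close>] by blast
  \<comment> \<open>The oscillation \<open>2 * A\<close> of \<open>v\<close> then allows the cone to
    rise by only \<open>k * (d / 4)\<close>; with rounding scale \<open>d / 2\<close> contact
    happens within \<open>3 * d / 4\<close> of \<open>x\<close>.\<close>
  define k where "k = 8 * A / d"
  have k: "k > 0" "2 * A = k * (d / 4)" using A(1) d(1) by (simp_all add: k_def)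
  define r where "r = (\<lambda>y. sqrt ((norm (y - x))\<^sup>2 + (d / 2)\<^sup>2))"
  have C1: "C1_with_gradient (\<lambda>y. k * r y) (\<lambda>y. (k / r y) *\<^sub>R (y - x))"
    unfolding r_def using d(1) by (intro C1_smoothed_cone) simp
  have "filterlim (\<lambda>y. k * r y) at_top at_infinity"
    unfolding r_def using k(1) by (rule filterlim_smoothed_cone)
  moreover have "v y \<le> A" for y using A(2)[of y] by linarith
  ultimately obtain z where z: "\<And>y. v y - k * r y \<le> v z - k * r z"
    using bounded_above_minus_coercive_attains_sup[OF v(1) C1_imp_continuous[OF C1]] by blast
  have "k * r x = k * (d / 2)" using d(1) by (simp add: r_def)
  then have "k * r z \<le> k * (d / 2) + k * (d / 4)"
    using z[of x] A(2)[of x] A(2)[of z] k(2) by linarith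
  then have "r z \<le> d / 2 + d / 4" using k(1) by (simp only: distrib_left[symmetric] mult_le_cancel_left_pos)
  moreover have "norm (z - x) \<le> r z" unfolding r_def by (rule real_le_rsqrt) simp
  ultimately have "dist x z < d" using d(1) by (simp add: dist_norm norm_minus_commute)
  then have "V x \<le> V z + e" using d(2)[of x z] unfolding dist_real_def by linarith
  moreover have "G ((k / r z) *\<^sub>R (z - x)) + V z \<le> c"
    by (rule viscosity_subsolutionD[OF sub C1 local_max_at_global]) (rule z)
  ultimately show "h + V x \<le> c + e" using G[of "(k / r z) *\<^sub>R (z - x)"] by linarith
qed

lemma minimum_eqI:
  assumes "\<And>y. f z \<le> f y"
  shows "minimum f = f z"
  unfolding minimum_def using assms by (intro Least_equality) auto

text \<open>At a minimum point of the corrector a constant touches from below, so the supersolution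
  property can be read off with gradient 0.\<close>

lemma cell_problem_upper_bound:
  assumes "cell_problem_solvable H V p c" and V: "\<And>x. V x \<le> b"
  shows "c \<le> H p + b"
proof -
  obtain v where v: "continuous_on UNIV v" "Zn_periodic v"
    and super: "viscosity_supersolution (\<lambda>q x. H (p + q) + V x) c v"
    using assms(1) unfolding cell_problem_solvable_def viscosity_solution_def by blast
  obtain x where "\<And>y. v x \<le> v y" using Zn_periodic_attains_inf[OF v] by blast
  then have "c \<le> H (p + 0) + V x"
    by (intro viscosity_supersolutionD[OF super C1_const[of 0]] local_min_at_global) simp
  then show ?thesis using V[of x] by simp
qed

text \<open>The lower bound is uniform in \<open>p\<close> because the least value of
  \<open>H\<close> bounds the kinetic part for every gradient. At \<open>z\<close> the upper bound
  meets it, so the minimum is attained, as the definition of \<open>minimum\<close>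
  requires.\<close>

lemma minimum_effective_hamiltonian:
  fixes H V :: "real ^ 'n \<Rightarrow> real"
  assumes H: "continuous_on UNIV H" "coercive H" and V: "continuous_on UNIV V" "Zn_periodic V"
    and H_min: "\<And>p. H z \<le> H p" and V_max: "\<And>x. V x \<le> V y"
  shows "minimum (effective_hamiltonian H V) = H z + V y"
proof -
  have lower: "H z + V y \<le> effective_hamiltonian H V p" for p
  proof -
    obtain v where "continuous_on UNIV v" "Zn_periodic v"
      "viscosity_subsolution (\<lambda>q x. H (p + q) + V x) (effective_hamiltonian H V p) v"
      using cell_problem_solvable_effective_hamiltonian[OF H V, of p]
      unfolding cell_problem_solvable_def viscosity_solution_def by blast
    then show ?thesis by (rule subsolution_lower_bound[OF _ _ V]) (rule H_min)
  qed
  have "effective_hamiltonian H V z \<le> H z + V y"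
    using cell_problem_solvable_effective_hamiltonian[OF H V] V_max by (rule cell_problem_upper_bound)
  then have "effective_hamiltonian H V z = H z + V y" using lower[of z] by linarith
  then show ?thesis using minimum_eqI[of "effective_hamiltonian H V" z] lower by simp
qed

text \<open>Testing any corrector with constants at a maximum point and at a minimum point gives the
  two inequalities.\<close>

lemma effective_hamiltonian_zero_potential:
  assumes H: "continuous_on UNIV H" "coercive H"
  shows "effective_hamiltonian H (\<lambda>x. 0) p = H p"
proof -
  let ?c = "effective_hamiltonian H (\<lambda>x. 0) p"
  have zero: "continuous_on UNIV (\<lambda>x :: real ^ 'a. 0 :: real)" "Zn_periodic (\<lambda>x :: real ^ 'a. 0)"
    by (auto simp: Zn_periodic_def)
  have solv: "cell_problem_solvable H (\<lambda>x. 0) p ?c"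
    by (rule cell_problem_solvable_effective_hamiltonian[OF H zero])
  then obtain v where v: "continuous_on UNIV v" "Zn_periodic v"
    and sub: "viscosity_subsolution (\<lambda>q x. H (p + q) + 0) ?c v"
    unfolding cell_problem_solvable_def viscosity_solution_def by blast
  obtain x where "\<And>y. v y \<le> v x" using Zn_periodic_attains_sup[OF v] by blast
  then have "H (p + 0) + 0 \<le> ?c"
    by (intro viscosity_subsolutionD[OF sub C1_const[of 0]] local_max_at_global) simp
  moreover have "?c \<le> H p + 0" using solv by (rule cell_problem_upper_bound) simp
  ultimately show ?thesis by simp
qed

theorem theorem1p1:
  fixes H V1 V2 Hbar1 Hbar2 :: "real ^ 'n \<Rightarrow> real" and p0 q0 :: "real ^ 'n"
  assumes "continuous_on UNIV H" and "coercive H"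
    and "continuous_on UNIV V1" and "Zn_periodic V1"
    and "V2 = (\<lambda>x. 0)"
    and "Hbar1 = effective_hamiltonian H V1"
    and "Hbar2 = effective_hamiltonian H V2"
    and "GDERIV H p0 :> q0" and "irrational_vector q0"
  shows "(Hbar1 p0 = Hbar2 p0 \<and> minimum Hbar1 = minimum Hbar2 \<longrightarrow> (\<forall>x. V1 x = 0))
       \<and> ((\<forall>p. Hbar1 p = Hbar2 p) \<longrightarrow> (\<forall>x. V1 x = 0))"
proof -
  note H = assms(1,2) and V1 = assms(3,4)
  have main: "V1 x = 0" if p0: "Hbar1 p0 = Hbar2 p0" and min_eq: "minimum Hbar1 = minimum Hbar2" for x
  proof -
    obtain z where z: "\<And>p. H z \<le> H p"
      using coercive_attains_inf[OF H(1)] H(2) unfolding coercive_def by blast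
    obtain y where y: "\<And>x. V1 x \<le> V1 y" using Zn_periodic_attains_sup[OF V1] by blast
    have Hbar2: "Hbar2 = H"
      using effective_hamiltonian_zero_potential[OF H] assms(5,7) by auto
    have "H z + V1 y = H z"
      using min_eq minimum_effective_hamiltonian[OF H V1 z y] minimum_eqI[of H z, OF z] Hbar2 assms(6) by simp
    then have nonpos: "V1 x \<le> 0" for x using y[of x] by simp
    have "cell_problem_solvable H V1 p0 (H p0)"
      using cell_problem_solvable_effective_hamiltonian[OF H V1, of p0] p0 Hbar2 assms(6) by simp
    then show ?thesis by (rule potential_vanishes[OF V1 nonpos assms(8,9)])
  qed
  moreover have "Hbar1 = Hbar2" if "\<forall>p. Hbar1 p = Hbar2 p"
    using that by (intro ext) blast
  ultimately show ?thesis by blast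
qed

end
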